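(* Let $v$ be a valuation on $\mathcal{A}_1(\mathbb{R})$, trivial on $\mathbb{R}$, with residue field $\mathbb{R}$. Then $v$ is strongly abelian, i.e. $v(ab-ba)>v(ab)$ for all nonzero $a,b\in\mathcal{D}_1(\mathbb{R})$.
   Context: A valuation on a division ring $D$ is a map $v:D\to\Gamma\cup\{\infty\}$, with $\Gamma$ an additively written (not necessarily abelian) totally ordered group and $\infty>\gamma$ for all $\gamma\in\Gamma$, such that $v(a)=\infty\iff a=0$, $v(ab)=v(a)+v(b)$ and $v(a+b)\ge\min\{v(a),v(b)\}$. Its residue division ring is $\{a: v(a)\ge 0\}/\{a: v(a)>0\}$. "Residue field $\mathbb{R}$" means that the natural map from $\mathbb{R}$ to the residue division ring is an isomorphism. The real Weyl algebra $\mathcal{A}_1(\mathbb{R})$ is the $\mathbb{R}$-algebra generated by $x,y$ subject to $yx-xy=1$. It is an Ore domain with quotient division ring $\mathcal{D}_1(\mathbb{R})$; a valuation on $\mathcal{A}_1(\mathbb{R})$ extends uniquely to $\mathcal{D}_1(\mathbb{R})$ and is identified with this extension (so value group and residue field are those of the extension). *)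

theory Defs
  imports Complex_Main "HOL-Algebra.QuotRing"
begin

section \<open>Totally ordered groups with a top element\<close>

class linordered_group_add = group_add + linorder +
  assumes group_add_left_mono: "a \<le> b \<Longrightarrow> c + a \<le> c + b"
    and group_add_right_mono: "a \<le> b \<Longrightarrow> a + c \<le> b + c"

datatype 'g val = Fin 'g | Infty

instantiation val :: (linorder) linorder
begin

fun less_eq_val :: "'a val \<Rightarrow> 'a val \<Rightarrow> bool" where
  "less_eq_val _ Infty = True"
| "less_eq_val Infty (Fin _) = False"
| "less_eq_val (Fin a) (Fin b) = (a \<le> b)"

definition less_val :: "'a val \<Rightarrow> 'a val \<Rightarrow> bool" where
  "less_val a b \<longleftrightarrow> a \<le> b \<and> \<not> b \<le> a"

instance
proof
  fix a b c :: "'a val"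
  show "a < b \<longleftrightarrow> a \<le> b \<and> \<not> b \<le> a" by (simp add: less_val_def)
  show "a \<le> a" by (cases a) auto
  show "a \<le> b \<Longrightarrow> b \<le> c \<Longrightarrow> a \<le> c" by (cases a; cases b; cases c) auto
  show "a \<le> b \<Longrightarrow> b \<le> a \<Longrightarrow> a = b" by (cases a; cases b) auto
  show "a \<le> b \<or> b \<le> a" by (cases a; cases b) auto
qed

end

lemma less_val_simps [simp]:
  "\<not> Infty < a" "Fin b < Infty" "Fin b < Fin c \<longleftrightarrow> b < c"
  by (cases a) (auto simp: less_val_def)

instantiation val :: (monoid_add) monoid_add
begin

definition zero_val :: "'a val" where
  "zero_val = Fin 0"

fun plus_val :: "'a val \<Rightarrow> 'a val \<Rightarrow> 'a val" where
  "plus_val (Fin a) (Fin b) = Fin (a + b)"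
| "plus_val Infty _ = Infty"
| "plus_val (Fin _) Infty = Infty"

instance
proof
  fix a b c :: "'a val"
  show "a + b + c = a + (b + c)" by (cases a; cases b; cases c) (auto simp: add.assoc)
  show "0 + a = a" "a + 0 = a" by (cases a; simp add: zero_val_def)+
qed

end


section \<open>Valuations\<close>

definition valuation :: "('a::ring_1 \<Rightarrow> 'g::linordered_group_add val) \<Rightarrow> bool" where
  "valuation v \<longleftrightarrow>
    (\<forall>a. v a = Infty \<longleftrightarrow> a = 0) \<and>
    (\<forall>a b. v (a * b) = v a + v b) \<and>
    (\<forall>a b. min (v a) (v b) \<le> v (a + b))"

definition trivial_on_reals :: "('a::real_algebra_1 \<Rightarrow> 'g::linordered_group_add val) \<Rightarrow> bool" where
  "trivial_on_reals v \<longleftrightarrow> (\<forall>r::real. r \<noteq> 0 \<longrightarrow> v (of_real r) = 0)"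

definition strongly_abelian :: "('d::division_ring \<Rightarrow> 'g::linordered_group_add val) \<Rightarrow> bool" where
  "strongly_abelian w \<longleftrightarrow> (\<forall>a b. a \<noteq> 0 \<longrightarrow> b \<noteq> 0 \<longrightarrow> w (a * b - b * a) > w (a * b))"

definition univ_ring :: "'a::ring_1 ring" where
  "univ_ring = \<lparr>carrier = UNIV, monoid.mult = (*), one = 1, zero = 0, add = (+)\<rparr>"

definition valuation_ring :: "('d::division_ring \<Rightarrow> 'g::linordered_group_add val) \<Rightarrow> 'd ring" where
  "valuation_ring w = univ_ring\<lparr>carrier := {a. 0 \<le> w a}\<rparr>"

definition valuation_ideal :: "('d::division_ring \<Rightarrow> 'g::linordered_group_add val) \<Rightarrow> 'd set" where
  "valuation_ideal w = {a. 0 < w a}"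

definition residue_ring :: "('d::division_ring \<Rightarrow> 'g::linordered_group_add val) \<Rightarrow> 'd set ring" where
  "residue_ring w = valuation_ring w Quot valuation_ideal w"

text \<open>Here \<open>j\<close> is the embedding of the reals in the division ring; the map is
  \<open>r \<mapsto> j r + {a. w a > 0}\<close>.\<close>

definition residue_field_real ::
  "(real \<Rightarrow> 'd::division_ring) \<Rightarrow> ('d \<Rightarrow> 'g::linordered_group_add val) \<Rightarrow> bool" where
  "residue_field_real j w \<longleftrightarrow>
    (\<lambda>r. valuation_ideal w +>\<^bsub>valuation_ring w\<^esub> j r) \<in> ring_iso univ_ring (residue_ring w)"


section \<open>The real Weyl algebra\<close>

text \<open>The presentation is taken literally: terms over the two generators, modulo the least congruence
  that contains the axioms of unital associative real algebras and the relation
  \<open>y x - x y = 1\<close>. Scalars enter as constants \<open>Const r\<close>, and \<open>-a\<close> is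
  \<open>Const (-1) a\<close>.\<close>

datatype weyl_term =
    GenX
  | GenY
  | Const real
  | Add weyl_term weyl_term
  | Mult weyl_term weyl_term

inductive weyl_eq :: "weyl_term \<Rightarrow> weyl_term \<Rightarrow> bool" where
  refl: "weyl_eq a a"
| sym: "weyl_eq a b \<Longrightarrow> weyl_eq b a"
| trans: "weyl_eq a b \<Longrightarrow> weyl_eq b c \<Longrightarrow> weyl_eq a c"
| add_cong: "weyl_eq a a' \<Longrightarrow> weyl_eq b b' \<Longrightarrow> weyl_eq (Add a b) (Add a' b')"
| mult_cong: "weyl_eq a a' \<Longrightarrow> weyl_eq b b' \<Longrightarrow> weyl_eq (Mult a b) (Mult a' b')"
| add_assoc: "weyl_eq (Add (Add a b) c) (Add a (Add b c))"
| add_comm: "weyl_eq (Add a b) (Add b a)"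
| add_zero: "weyl_eq (Add (Const 0) a) a"
| add_neg: "weyl_eq (Add (Mult (Const (-1)) a) a) (Const 0)"
| mult_assoc: "weyl_eq (Mult (Mult a b) c) (Mult a (Mult b c))"
| mult_one_left: "weyl_eq (Mult (Const 1) a) a"
| mult_one_right: "weyl_eq (Mult a (Const 1)) a"
| distrib_right: "weyl_eq (Mult (Add a b) c) (Add (Mult a c) (Mult b c))"
| distrib_left: "weyl_eq (Mult a (Add b c)) (Add (Mult a b) (Mult a c))"
| const_add: "weyl_eq (Const (r + s)) (Add (Const r) (Const s))"
| const_mult: "weyl_eq (Const (r * s)) (Mult (Const r) (Const s))"
| const_central: "weyl_eq (Mult (Const r) a) (Mult a (Const r))"
| weyl_relation: "weyl_eq (Add (Mult GenY GenX) (Mult (Const (-1)) (Mult GenX GenY))) (Const 1)"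

quotient_type weyl = weyl_term / weyl_eq
  by (intro equivpI reflpI sympI transpI) (rule weyl_eq.refl, erule weyl_eq.sym, erule (1) weyl_eq.trans)

text \<open>The action on coefficient sequences of real power series (\<open>x\<close> multiplies by the
  indeterminate, \<open>y\<close> differentiates) shows that the quotient does not collapse.\<close>

primrec weyl_act :: "weyl_term \<Rightarrow> (nat \<Rightarrow> real) \<Rightarrow> nat \<Rightarrow> real" where
  "weyl_act GenX f = (\<lambda>n. if n = 0 then 0 else f (n - 1))"
| "weyl_act GenY f = (\<lambda>n. real (n + 1) * f (n + 1))"
| "weyl_act (Const r) f = (\<lambda>n. r * f n)"
| "weyl_act (Add a b) f = (\<lambda>n. weyl_act a f n + weyl_act b f n)"
| "weyl_act (Mult a b) f = weyl_act a (weyl_act b f)"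

lemma weyl_act_linear:
  "weyl_act a (\<lambda>n. r * f n + s * g n) = (\<lambda>n. r * weyl_act a f n + s * weyl_act a g n)"
proof (induction a arbitrary: f g)
  case (Add a b)
  show ?case by (simp add: Add.IH algebra_simps)
next
  case (Mult a b)
  show ?case by (simp add: Mult.IH)
qed (simp_all add: fun_eq_iff algebra_simps)

lemma weyl_act_add: "weyl_act a (\<lambda>n. f n + g n) = (\<lambda>n. weyl_act a f n + weyl_act a g n)"
  using weyl_act_linear[of a 1 f 1 g] by simp

lemma weyl_act_scale: "weyl_act a (\<lambda>n. r * f n) = (\<lambda>n. r * weyl_act a f n)"
  using weyl_act_linear[of a r f 0 f] by simp

lemma weyl_act_sound: "weyl_eq a b \<Longrightarrow> weyl_act a = weyl_act b"
proof (induction rule: weyl_eq.induct)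
  case (mult_cong a a' b b')
  then show ?case by (intro ext) simp
qed (auto simp: fun_eq_iff weyl_act_add weyl_act_scale weyl_act_scale[where r = "-1", simplified]
       algebra_simps)

instantiation weyl :: real_algebra_1
begin

lift_definition zero_weyl :: weyl is "Const 0" .
lift_definition one_weyl :: weyl is "Const 1" .
lift_definition plus_weyl :: "weyl \<Rightarrow> weyl \<Rightarrow> weyl" is Add by (rule weyl_eq.add_cong)
lift_definition times_weyl :: "weyl \<Rightarrow> weyl \<Rightarrow> weyl" is Mult by (rule weyl_eq.mult_cong)
lift_definition uminus_weyl :: "weyl \<Rightarrow> weyl" is "Mult (Const (-1))"
  by (intro weyl_eq.mult_cong weyl_eq.refl)
lift_definition scaleR_weyl :: "real \<Rightarrow> weyl \<Rightarrow> weyl" is "\<lambda>r. Mult (Const r)"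
  by (intro weyl_eq.mult_cong weyl_eq.refl)
definition minus_weyl :: "weyl \<Rightarrow> weyl \<Rightarrow> weyl" where "minus_weyl a b = a + - b"

instance
proof
  fix a b c :: weyl and r s :: real
  show "a + b + c = a + (b + c)" by transfer (rule weyl_eq.add_assoc)
  show "a + b = b + a" by transfer (rule weyl_eq.add_comm)
  show "0 + a = a" by transfer (rule weyl_eq.add_zero)
  show "- a + a = 0" by transfer (rule weyl_eq.add_neg)
  show "a - b = a + - b" by (rule minus_weyl_def)
  show "a * b * c = a * (b * c)" by transfer (rule weyl_eq.mult_assoc)
  show "1 * a = a" by transfer (rule weyl_eq.mult_one_left)
  show "a * 1 = a" by transfer (rule weyl_eq.mult_one_right)
  show "(a + b) * c = a * c + b * c" by transfer (rule weyl_eq.distrib_right)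
  show "a * (b + c) = a * b + a * c" by transfer (rule weyl_eq.distrib_left)
  show "r *\<^sub>R (a + b) = r *\<^sub>R a + r *\<^sub>R b" by transfer (rule weyl_eq.distrib_left)
  show "(r + s) *\<^sub>R a = r *\<^sub>R a + s *\<^sub>R a"
    by transfer (rule weyl_eq.trans[OF weyl_eq.mult_cong[OF weyl_eq.const_add weyl_eq.refl]
      weyl_eq.distrib_right])
  show "r *\<^sub>R s *\<^sub>R a = (r * s) *\<^sub>R a"
    by transfer (rule weyl_eq.trans[OF weyl_eq.sym[OF weyl_eq.mult_assoc]
      weyl_eq.mult_cong[OF weyl_eq.sym[OF weyl_eq.const_mult] weyl_eq.refl]])
  show "1 *\<^sub>R a = a" by transfer (rule weyl_eq.mult_one_left)
  show "r *\<^sub>R a * b = r *\<^sub>R (a * b)" by transfer (rule weyl_eq.mult_assoc)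
  show "a * r *\<^sub>R b = r *\<^sub>R (a * b)"
    by transfer (rule weyl_eq.trans[OF weyl_eq.sym[OF weyl_eq.mult_assoc] weyl_eq.trans[OF
      weyl_eq.mult_cong[OF weyl_eq.sym[OF weyl_eq.const_central] weyl_eq.refl] weyl_eq.mult_assoc]])
  show "(0::weyl) \<noteq> 1"
  proof (transfer, rule notI)
    assume "weyl_eq (Const 0) (Const 1)"
    then have "weyl_act (Const 0) (\<lambda>_. 1) 0 = weyl_act (Const 1) (\<lambda>_. 1) 0"
      by (simp only: weyl_act_sound)
    then show False by simp
  qed
qed

end

lift_definition weyl_x :: weyl is GenX .
lift_definition weyl_y :: weyl is GenY .

lemma weyl_commutator: "weyl_y * weyl_x - weyl_x * weyl_y = 1"
  unfolding minus_weyl_def by transfer (rule weyl_eq.weyl_relation)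

lemma of_real_weyl: "of_real r = abs_weyl (Const r)"
proof -
  have "r *\<^sub>R (1::weyl) = abs_weyl (Const r)"
    by (simp add: one_weyl_def scaleR_weyl.abs_eq weyl.abs_eq_iff weyl_eq.mult_one_right)
  then show ?thesis by (simp add: of_real_def)
qed

lemma weyl_induct [case_names x y of_real add mult]:
  assumes "P weyl_x" "P weyl_y" "\<And>r. P (of_real r)"
    and "\<And>a b. P a \<Longrightarrow> P b \<Longrightarrow> P (a + b)" "\<And>a b. P a \<Longrightarrow> P b \<Longrightarrow> P (a * b)"
  shows "P a"
proof -
  have "P (abs_weyl t)" for t
  proof (induction t)
    case GenX then show ?case using assms(1) by (simp add: weyl_x_def)
  next
    case GenY then show ?case using assms(2) by (simp add: weyl_y_def)
  next
    case (Const r) then show ?case using assms(3)[of r] by (simp add: of_real_weyl)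
  next
    case (Add s t) then show ?case using assms(4) by (simp flip: plus_weyl.abs_eq)
  next
    case (Mult s t) then show ?case using assms(5) by (simp flip: times_weyl.abs_eq)
  qed
  then show ?thesis by (metis Quotient_abs_rep Quotient_weyl)
qed

primrec weyl_eval :: "'b::real_algebra_1 \<Rightarrow> 'b \<Rightarrow> weyl_term \<Rightarrow> 'b" where
  "weyl_eval p q GenX = p"
| "weyl_eval p q GenY = q"
| "weyl_eval p q (Const r) = of_real r"
| "weyl_eval p q (Add a b) = weyl_eval p q a + weyl_eval p q b"
| "weyl_eval p q (Mult a b) = weyl_eval p q a * weyl_eval p q b"

theorem weyl_universal_property:
  fixes p q :: "'b::real_algebra_1"
  assumes pq: "q * p - p * q = 1"
  shows "\<exists>!h :: weyl \<Rightarrow> 'b. h weyl_x = p \<and> h weyl_y = q \<and> (\<forall>r. h (of_real r) = of_real r) \<and>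
    (\<forall>a b. h (a + b) = h a + h b) \<and> (\<forall>a b. h (a * b) = h a * h b)"
proof (rule ex1I)
  have sound: "weyl_eval p q a = weyl_eval p q b" if "weyl_eq a b" for a b
    using that
    by (induction rule: weyl_eq.induct) (use pq in \<open>auto simp: algebra_simps of_real_def\<close>)
  define h where "h a = weyl_eval p q (rep_weyl a)" for a
  have h: "h (abs_weyl t) = weyl_eval p q t" for t
    unfolding h_def using sound Quotient_rep_abs[OF Quotient_weyl] weyl_eq.refl by blast
  have rep: "\<exists>t. a = abs_weyl t" for a
    by (metis Quotient_abs_rep Quotient_weyl)
  have hom: "h (a + b) = h a + h b" "h (a * b) = h a * h b" for a b
    using rep[of a] rep[of b] by (auto simp: plus_weyl.abs_eq times_weyl.abs_eq h)
  then show "h weyl_x = p \<and> h weyl_y = q \<and> (\<forall>r. h (of_real r) = of_real r) \<and>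
    (\<forall>a b. h (a + b) = h a + h b) \<and> (\<forall>a b. h (a * b) = h a * h b)"
    by (simp add: weyl_x_def weyl_y_def of_real_weyl h)
  fix k assume k: "k weyl_x = p \<and> k weyl_y = q \<and> (\<forall>r. k (of_real r) = of_real r) \<and>
    (\<forall>a b. k (a + b) = k a + k b) \<and> (\<forall>a b. k (a * b) = k a * k b)"
  have "k a = h a" for a
    by (induction a rule: weyl_induct)
       (use k in \<open>simp_all add: hom weyl_x_def weyl_y_def of_real_weyl h\<close>)
  then show "k = h" ..
qed


section \<open>The quotient division ring\<close>

text \<open>A quotient division ring is determined up to unique isomorphism, and is given by an
  embedding \<open>\<iota>\<close> in a division ring whose elements are all right fractions.\<close>

definition quotient_division_ring :: "('a::ring_1 \<Rightarrow> 'd::division_ring) \<Rightarrow> bool" where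
  "quotient_division_ring \<iota> \<longleftrightarrow>
    \<iota> 1 = 1 \<and> (\<forall>a b. \<iota> (a + b) = \<iota> a + \<iota> b) \<and> (\<forall>a b. \<iota> (a * b) = \<iota> a * \<iota> b) \<and> inj \<iota> \<and>
    (\<forall>d. \<exists>a b. b \<noteq> 0 \<and> d = \<iota> a * inverse (\<iota> b))"

text \<open>The description below is proper by \<open>extension_exists_unique\<close>.\<close>

definition extension ::
  "('a::ring_1 \<Rightarrow> 'd::division_ring) \<Rightarrow> ('a \<Rightarrow> 'g::linordered_group_add val) \<Rightarrow> 'd \<Rightarrow> 'g val" where
  "extension \<iota> v = (THE w. valuation w \<and> (\<forall>a. w (\<iota> a) = v a))"

theorem extension_exists_unique:
  fixes \<iota> :: "'a::ring_1 \<Rightarrow> 'd::division_ring" and v :: "'a \<Rightarrow> 'g::linordered_group_add val"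
  assumes \<iota>: "quotient_division_ring \<iota>" and v: "valuation v"
  shows "\<exists>!w. valuation w \<and> (\<forall>a. w (\<iota> a) = v a)"
proof -
  have one: "\<iota> 1 = 1" and add: "\<iota> (a + b) = \<iota> a + \<iota> b" and mult: "\<iota> (a * b) = \<iota> a * \<iota> b" and "inj \<iota>"
    and frac: "\<exists>a b. b \<noteq> 0 \<and> d = \<iota> a * inverse (\<iota> b)" for a b d
    using \<iota> unfolding quotient_division_ring_def by blast+
  have zero: "\<iota> 0 = 0" using add[of 0 0] by simp
  have eq_iff: "\<iota> a = \<iota> b \<longleftrightarrow> a = b" for a b using \<open>inj \<iota>\<close> by (simp add: inj_eq)
  have zero_iff: "\<iota> a = 0 \<longleftrightarrow> a = 0" for a using eq_iff[of a 0] zero by simp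
  have dom: "a * b = 0 \<longleftrightarrow> a = 0 \<or> b = 0" for a b :: 'a
    using zero_iff[of "a * b"] by (simp add: mult zero_iff)
  have v_inf: "v a = Infty \<longleftrightarrow> a = 0" and v_mult: "v (a * b) = v a + v b"
    and v_add: "min (v a) (v b) \<le> v (a + b)" for a b
    using v unfolding valuation_def by blast+
  define g where "g a = (case v a of Fin x \<Rightarrow> x | Infty \<Rightarrow> 0)" for a
  have vg: "v a = Fin (g a)" if "a \<noteq> 0" for a
    using that v_inf[of a] by (cases "v a") (auto simp: g_def)
  have g_mult: "g (a * b) = g a + g b" if "a \<noteq> 0" "b \<noteq> 0" for a b
    using v_mult[of a b] that by (simp add: vg dom)
  have g_one: "g 1 = 0"
  proof -
    have "(1::'a) \<noteq> 0" by simp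
    from g_mult[OF this this] have "g 1 + g 1 = g 1 + 0" by simp
    then show ?thesis by (simp only: add_left_cancel)
  qed
  have expand: "v (a * c) + Fin (- g (b * c)) = v a + Fin (- g b)" if "b \<noteq> 0" "c \<noteq> 0" for a b c
  proof -
    have "x + g c + - (g b + g c) = x + - g b" for x
      by (simp only: minus_add add.assoc add_minus_cancel)
    then show ?thesis by (cases "v a") (use that in \<open>simp_all add: v_mult g_mult vg\<close>)
  qed
  have ore: "\<exists>c d. d \<noteq> 0 \<and> b * c = a * d \<and> inverse (\<iota> b) * \<iota> a = \<iota> c * inverse (\<iota> d)"
    if b: "b \<noteq> 0" for a b
  proof -
    obtain c d where d: "d \<noteq> 0" and eq: "inverse (\<iota> b) * \<iota> a = \<iota> c * inverse (\<iota> d)"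
      using frac by blast
    have "\<iota> b * (inverse (\<iota> b) * \<iota> a) * \<iota> d = \<iota> b * (\<iota> c * inverse (\<iota> d)) * \<iota> d"
      using eq by simp
    moreover have "\<iota> b * (inverse (\<iota> b) * \<iota> a) * \<iota> d = \<iota> (a * d)"
      using b by (simp add: mult zero_iff flip: mult.assoc)
    moreover have "\<iota> b * (\<iota> c * inverse (\<iota> d)) * \<iota> d = \<iota> (b * c)"
      using d by (simp add: mult zero_iff mult.assoc)
    ultimately have "b * c = a * d" by (simp add: eq_iff)
    with d eq show ?thesis by blast
  qed
  have cancel: "\<iota> (a * c) * inverse (\<iota> (b * c)) = \<iota> a * inverse (\<iota> b)"
    if "b \<noteq> 0" "c \<noteq> 0" for a b c
  proof -
    have "\<iota> (a * c) * inverse (\<iota> (b * c)) = \<iota> a * (\<iota> c * inverse (\<iota> c)) * inverse (\<iota> b)"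
      using that by (simp add: mult zero_iff nonzero_inverse_mult_distrib mult.assoc del: right_inverse)
    then show ?thesis using that by (simp add: zero_iff)
  qed
  have common: "\<exists>a a' b. b \<noteq> 0 \<and> d = \<iota> a * inverse (\<iota> b) \<and> d' = \<iota> a' * inverse (\<iota> b)" for d d'
  proof -
    obtain a b a' b' where b: "b \<noteq> 0" "b' \<noteq> 0"
      and d: "d = \<iota> a * inverse (\<iota> b)" "d' = \<iota> a' * inverse (\<iota> b')"
      using frac by metis
    obtain c e where e: "e \<noteq> 0" "b * c = b' * e" using ore[OF b(1), of b'] by blast
    have "b * c \<noteq> 0" using e b by (simp add: dom)
    then have "c \<noteq> 0" by (simp add: dom)
    have "d = \<iota> (a * c) * inverse (\<iota> (b * c))" using cancel[OF b(1) \<open>c \<noteq> 0\<close>] d by simp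
    moreover have "d' = \<iota> (a' * e) * inverse (\<iota> (b * c))" using cancel[OF b(2) e(1)] d e(2) by simp
    ultimately show ?thesis using \<open>b * c \<noteq> 0\<close> by blast
  qed
  have well_defined: "v a + Fin (- g b) = v a' + Fin (- g b')"
    if b: "b \<noteq> 0" "b' \<noteq> 0" and eq: "\<iota> a * inverse (\<iota> b) = \<iota> a' * inverse (\<iota> b')" for a b a' b'
  proof -
    obtain c e where e: "e \<noteq> 0" "b * c = b' * e" using ore[OF b(1), of b'] by blast
    have nz: "b * c \<noteq> 0" using e b by (simp add: dom)
    then have "c \<noteq> 0" by (simp add: dom)
    have "\<iota> (a * c) * inverse (\<iota> (b * c)) = \<iota> (a' * e) * inverse (\<iota> (b * c))"
      using eq cancel[OF b(1) \<open>c \<noteq> 0\<close>] cancel[OF b(2) e(1)] e(2) by simp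
    then have "a * c = a' * e" using nz by (simp add: zero_iff eq_iff)
    then show ?thesis
      using expand[OF b(1) \<open>c \<noteq> 0\<close>, of a] expand[OF b(2) e(1), of a'] e(2) by simp
  qed
  obtain num den where nd: "den d \<noteq> 0" "d = \<iota> (num d) * inverse (\<iota> (den d))" for d
    using frac by metis
  define w where "w d = v (num d) + Fin (- g (den d))" for d
  have w: "w (\<iota> a * inverse (\<iota> b)) = v a + Fin (- g b)" if "b \<noteq> 0" for a b
    unfolding w_def by (rule well_defined) (use nd that in auto)
  have w_ext: "w (\<iota> a) = v a" for a
    using w[of 1 a] by (cases "v a") (simp_all add: one g_one)
  have "valuation w"
    unfolding valuation_def
  proof (intro conjI allI)
    fix d
    have "w d = Infty \<longleftrightarrow> num d = 0"
      unfolding w_def by (cases "v (num d)") (use v_inf[of "num d"] in auto)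
    then show "w d = Infty \<longleftrightarrow> d = 0"
      using nd[of d] by (metis zero_iff mult_eq_0_iff nonzero_imp_inverse_nonzero)
  next
    fix d d'
    obtain a b where b: "b \<noteq> 0" and d: "d = \<iota> a * inverse (\<iota> b)" using frac by blast
    obtain a' b' where b': "b' \<noteq> 0" and d': "d' = \<iota> a' * inverse (\<iota> b')" using frac by blast
    obtain c e where e: "e \<noteq> 0" "b * c = a' * e" "inverse (\<iota> b) * \<iota> a' = \<iota> c * inverse (\<iota> e)"
      using ore[OF b] by blast
    have "d * d' = \<iota> a * (inverse (\<iota> b) * \<iota> a') * inverse (\<iota> b')"
      by (simp add: d d' mult.assoc)
    also have "\<dots> = \<iota> (a * c) * inverse (\<iota> (b' * e))"
      using e(1) b' by (simp add: e(3) mult zero_iff nonzero_inverse_mult_distrib mult.assoc)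
    finally have "w (d * d') = v a + v c + Fin (- g (b' * e))"
      using w[of "b' * e" "a * c"] b' e(1) by (simp add: dom v_mult)
    also have "\<dots> = v a + (v c + Fin (- g e)) + Fin (- g b')"
    proof -
      have "x + y + - (g b' + g e) = x + (y + - g e) + - g b'" for x y
        by (simp only: minus_add add.assoc)
      then show ?thesis using b' e(1) by (cases "v a"; cases "v c") (simp_all add: g_mult)
    qed
    also have "v c + Fin (- g e) = Fin (- g b) + v a'"
    proof (cases "a' = 0")
      case True
      with e b have "c = 0" by (simp add: dom)
      with True v_inf[of 0] show ?thesis by simp
    next
      case False
      with e have "b * c \<noteq> 0" by (simp add: dom)
      then have c: "c \<noteq> 0" by (simp add: dom)
      have "g b + g c = g a' + g e"
        using e False b c g_mult by metis
      then have "g c - g e = - g b + g a'"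
        by (metis add.assoc add_diff_cancel minus_add_cancel)
      then show ?thesis using c False by (simp add: vg)
    qed
    also have "v a + (Fin (- g b) + v a') + Fin (- g b') = w d + w d'"
      using w[OF b] w[OF b'] by (simp add: d d' add.assoc)
    finally show "w (d * d') = w d + w d'" .
  next
    fix d d'
    obtain a a' b where b: "b \<noteq> 0" "d = \<iota> a * inverse (\<iota> b)" "d' = \<iota> a' * inverse (\<iota> b)"
      using common by blast
    have mono: "x + Fin z \<le> y + Fin z" if "x \<le> y" for x y :: "'g val" and z
      using that by (cases x; cases y) (auto intro: group_add_right_mono)
    have "d + d' = \<iota> (a + a') * inverse (\<iota> b)"
      by (simp add: b add semiring_class.distrib_right)
    then have "w (d + d') = v (a + a') + Fin (- g b)" using w b by simp
    moreover have "w d = v a + Fin (- g b)" "w d' = v a' + Fin (- g b)" using w b by auto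
    ultimately show "min (w d) (w d') \<le> w (d + d')"
      using v_add[of a a'] mono unfolding min_le_iff_disj by auto
  qed
  moreover have "u = w" if u: "valuation u" and ext: "\<And>a. u (\<iota> a) = v a" for u
  proof
    fix d
    obtain a b where b: "b \<noteq> 0" "d = \<iota> a * inverse (\<iota> b)" using frac by blast
    have u_mult: "u (x * y) = u x + u y" for x y using u unfolding valuation_def by blast
    have "u d + v b = v a"
      using b u_mult[of d "\<iota> b"] by (simp add: ext zero_iff mult.assoc)
    then have "u d + (v b + Fin (- g b)) = v a + Fin (- g b)" by (simp flip: add.assoc)
    then have "u d = v a + Fin (- g b)"
      using b(1) by (simp add: vg flip: zero_val_def)
    then show "u d = w d" using w b by simp
  qed
  ultimately show ?thesis using w_ext by blast
qed

end

theory Submission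
  imports Defs
begin

text \<open>Write \<open>a ~ b\<close> if \<open>v (a - b) > v a\<close>; since the residue field is \<open>\<real>\<close>, elements of equal value are
  proportional up to \<open>~\<close>. A shift \<open>x - r\<close> of the first generator has nonzero value, and we call it \<open>x\<close>.
  The inner derivation \<open>der = [-, x]\<close> is locally nilpotent, which forces \<open>a x ~ x a\<close> for all \<open>a\<close>.
  Elements of distinct values are linearly independent, so quadratic growth of the Weyl algebra makes
  the values of any three elements dependent. With one of them equal to \<open>x\<close> this shows that
  the value group is abelian, and that \<open>a b ~ \<lambda>(a, b) b a\<close> for a bimultiplicative \<open>\<lambda>\<close> with values in the real
  roots of unity, that is, in \<open>{1, -1}\<close>. The sign \<open>\<lambda>(a, b)\<close> is trivial if \<open>v a\<close> and \<open>v b\<close> are dependent.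

  Suppose the sign is nontrivial. Then \<open>v (der a) - v a\<close> attains a minimum at some \<open>s\<close>: take \<open>b\<close> of
  minimal degree with value not rationally dependent on \<open>v x\<close>; below its degree the values lie in
  finitely many cosets of \<open>\<int> v x\<close>, and expansions in powers of \<open>b\<close> reduce the general case to this one.
  The residue \<open>\<chi>(a)\<close> of \<open>(der a / a) / (der s / s)\<close> is then a homomorphism from the value group to \<open>\<real>\<close>.
  If \<open>\<lambda>(f, b) = -1\<close> and \<open>\<chi>(b) \<noteq> 0\<close>, then \<open>\<lambda>(f, der b) = -1\<close> as well, so by descent on the degree we may
  assume \<open>\<chi>(b) = 0\<close>, and by symmetry \<open>\<chi>(f) = 0\<close>. But a dependence between \<open>f\<close>, \<open>b\<close>, \<open>s\<close> cannot
  involve \<open>s\<close>, because \<open>\<chi>(s) \<noteq> 0\<close>; so \<open>v f\<close> and \<open>v b\<close> are dependent and \<open>\<lambda>(f, b) = 1\<close>.\<close>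


section \<open>Values with a top element\<close>

lemma val_add_left_mono: "a \<le> b \<Longrightarrow> c + a \<le> c + b" for a b c :: "'g::linordered_group_add val"
  by (cases a; cases b; cases c) (auto intro: group_add_left_mono)

lemma val_add_right_mono: "a \<le> b \<Longrightarrow> a + c \<le> b + c" for a b c :: "'g::linordered_group_add val"
  by (cases a; cases b; cases c) (auto intro: group_add_right_mono)

lemma val_add_left_cancel: "c \<noteq> Infty \<Longrightarrow> c + a = c + b \<longleftrightarrow> a = b" for a b c :: "'g::linordered_group_add val"
  by (cases a; cases b; cases c) auto

lemma val_add_right_cancel: "c \<noteq> Infty \<Longrightarrow> a + c = b + c \<longleftrightarrow> a = b" for a b c :: "'g::linordered_group_add val"
  by (cases a; cases b; cases c) auto

lemma val_add_left_strict_mono: "a < b \<Longrightarrow> c \<noteq> Infty \<Longrightarrow> c + a < c + b" for a b c :: "'g::linordered_group_add val"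
  using val_add_left_mono[of a b c] val_add_left_cancel[of c a b] by (auto simp: order.strict_iff_order)

lemma val_add_right_strict_mono: "a < b \<Longrightarrow> c \<noteq> Infty \<Longrightarrow> a + c < b + c" for a b c :: "'g::linordered_group_add val"
  using val_add_right_mono[of a b c] val_add_right_cancel[of c a b] by (auto simp: order.strict_iff_order)

lemma val_less_Infty_iff: "a < (Infty :: 'g::linorder val) \<longleftrightarrow> a \<noteq> Infty"
  by (cases a) auto

lemma val_add_eq_Infty [simp]: "a + b = Infty \<longleftrightarrow> a = Infty \<or> b = (Infty :: 'g::linordered_group_add val)"
  by (cases a; cases b) auto

lemma val_zero_neq_Infty [simp]: "(0 :: 'g::linordered_group_add val) \<noteq> Infty" "Infty \<noteq> (0 :: 'g val)"
  by (auto simp: zero_val_def)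

lemma val_Infty_add [simp]: "Infty + a = Infty" "a + Infty = (Infty :: 'g::linordered_group_add val)"
  by (cases a; simp)+


section \<open>Weyl pairs\<close>

text \<open>Kept abstract because \<open>x\<close> will be a shift of the first generator by a
  real.\<close>

locale weyl_pair =
  fixes x y :: "'a::real_algebra_1"
  assumes commutator: "y * x = x * y + 1"
begin

section \<open>The inner derivation given by \<open>x\<close>\<close>

definition der :: "'a \<Rightarrow> 'a" where
  "der a = a * x - x * a"

lemma der_simps [simp]: "der 0 = 0" "der 1 = 0" "der x = 0" "der y = 1"
  "der (a + b) = der a + der b" "der (a - b) = der a - der b" "der (- a) = - der a"
  "der (r *\<^sub>R a) = r *\<^sub>R der a"
  by (auto simp: der_def commutator algebra_simps)

lemma der_mult: "der (a * b) = der a * b + a * der b"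
  by (simp add: der_def algebra_simps)

lemma der_pow_simps [simp]: "(der ^^ n) 0 = 0"
  "(der ^^ n) (a + b) = (der ^^ n) a + (der ^^ n) b" "(der ^^ n) (a - b) = (der ^^ n) a - (der ^^ n) b"
  "(der ^^ n) (r *\<^sub>R a) = r *\<^sub>R (der ^^ n) a"
  by (induction n) auto

lemma der_pow_Suc: "(der ^^ Suc n) a = (der ^^ n) (der a)"
  by (simp add: funpow_swap1)

lemma der_pow_mono: "(der ^^ n) a = 0 \<Longrightarrow> n \<le> m \<Longrightarrow> (der ^^ m) a = 0"
  using der_pow_simps(1)[of "m - n"] funpow_add[of "m - n" n der] by simp

lemma der_pow_const_mult: "der c = 0 \<Longrightarrow> (der ^^ n) (c * a) = c * (der ^^ n) a"
  by (induction n) (auto simp: der_mult)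

lemma der_pow_mult_const: "der c = 0 \<Longrightarrow> (der ^^ n) (a * c) = (der ^^ n) a * c"
  by (induction n) (auto simp: der_mult)

text \<open>Each Leibniz term applies \<open>der\<close> at least \<open>n\<close> times to
  \<open>a\<close> or at least \<open>m\<close> times to \<open>b\<close>; the induction lowers one
  bound at a time.\<close>

lemma der_pow_prod: "(der ^^ n) a = 0 \<Longrightarrow> (der ^^ m) b = 0 \<Longrightarrow> (der ^^ (n + m - 1)) (a * b) = 0"
proof (induction "n + m" arbitrary: n m a b)
  case (Suc k)
  show ?case
  proof (cases "n = 0 \<or> m = 0")
    case True
    with Suc.prems show ?thesis by auto
  next
    case False
    then obtain n' m' where nm: "n = Suc n'" "m = Suc m'" by (metis not0_implies_Suc)
    have "(der ^^ (n' + m - 1)) (der a * b) = 0" "(der ^^ (n + m' - 1)) (a * der b) = 0"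
      using Suc.prems Suc.hyps(2) nm
      by (intro Suc.hyps(1); simp flip: der_pow_Suc del: funpow.simps)+
    then show ?thesis
      by (simp add: nm der_pow_Suc der_mult del: funpow.simps)
  qed
qed auto

lemma der_y_pow: "der (y ^ n) = real n *\<^sub>R y ^ (n - 1)"
proof (induction n)
  case (Suc n)
  then show ?case
    by (cases n) (auto simp: der_mult algebra_simps scaleR_2)
qed auto

lemma der_pow_y_pow: "(der ^^ n) (y ^ n) = fact n *\<^sub>R 1"
proof (induction n)
  case (Suc n)
  then show ?case
    by (simp add: der_pow_Suc der_y_pow del: funpow.simps power_Suc)
qed auto

lemma y_mult_x_pow: "y * x ^ i = x ^ i * y + real i *\<^sub>R x ^ (i - 1)"
proof (induction i)
  case (Suc i)
  have "y * x ^ Suc i = (y * x) * x ^ i" by (simp add: mult.assoc)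
  also have "\<dots> = x * (y * x ^ i) + x ^ i" by (simp add: commutator algebra_simps)
  also have "\<dots> = x ^ Suc i * y + real (Suc i) *\<^sub>R x ^ i"
    using Suc by (cases i) (auto simp: algebra_simps scaleR_2)
  finally show ?case by simp
qed auto

section \<open>The filtration by bidegree in \<open>x\<close> and \<open>y\<close>\<close>

definition box :: "nat \<Rightarrow> nat \<Rightarrow> 'a set" where
  "box m n = span ((\<lambda>(i, j). x ^ i * y ^ j) ` ({..m} \<times> {..n}))"

lemma box_base: "i \<le> m \<Longrightarrow> j \<le> n \<Longrightarrow> x ^ i * y ^ j \<in> box m n"
  unfolding box_def by (intro span_base) auto

lemma box_closed: "0 \<in> box m n" "a \<in> box m n \<Longrightarrow> b \<in> box m n \<Longrightarrow> a + b \<in> box m n"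
  "a \<in> box m n \<Longrightarrow> r *\<^sub>R a \<in> box m n"
  unfolding box_def by (auto intro: span_zero span_add span_scale)

lemma box_mono: "a \<in> box m n \<Longrightarrow> m \<le> m' \<Longrightarrow> n \<le> n' \<Longrightarrow> a \<in> box m' n'"
  unfolding box_def by (erule subsetD[OF span_mono, rotated]) auto

lemma box_induct [consumes 1, case_names zero step]:
  assumes "a \<in> box m n" "P 0"
    and "\<And>r i j a. i \<le> m \<Longrightarrow> j \<le> n \<Longrightarrow> a \<in> box m n \<Longrightarrow> P a \<Longrightarrow> P (r *\<^sub>R (x ^ i * y ^ j) + a)"
  shows "P a"
proof -
  have "a \<in> box m n \<and> P a"
    using assms(1) unfolding box_def
  proof (induction rule: span_induct_alt)
    case base
    show ?case using assms(2) box_closed unfolding box_def by auto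
  next
    case (step c u a)
    then show ?case using assms(3) box_base box_closed unfolding box_def by fastforce
  qed
  then show ?thesis ..
qed

lemma x_mult_box: "a \<in> box m n \<Longrightarrow> x * a \<in> box (Suc m) n"
proof (induction rule: box_induct)
  case (step r i j a)
  then have "r *\<^sub>R (x ^ Suc i * y ^ j) + x * a \<in> box (Suc m) n"
    by (intro box_closed box_base) auto
  then show ?case by (simp add: algebra_simps)
qed (simp add: box_closed)

lemma y_mult_box: "a \<in> box m n \<Longrightarrow> y * a \<in> box m (Suc n)"
proof (induction rule: box_induct)
  case (step r i j a)
  then have "r *\<^sub>R (x ^ i * y ^ Suc j + real i *\<^sub>R (x ^ (i - 1) * y ^ j)) + y * a \<in> box m (Suc n)"
    by (intro box_closed box_base) auto
  moreover have "y * (x ^ i * y ^ j) = x ^ i * y ^ Suc j + real i *\<^sub>R (x ^ (i - 1) * y ^ j)"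
    by (simp add: mult.assoc[symmetric] y_mult_x_pow) (simp add: algebra_simps)
  ultimately show ?case by (simp add: algebra_simps)
qed (simp add: box_closed)

text \<open>Moving \<open>y\<close> past a power of \<open>x\<close> adds only a term of lower
  bidegree.\<close>

lemma box_mult: "a \<in> box m n \<Longrightarrow> b \<in> box m' n' \<Longrightarrow> a * b \<in> box (m + m') (n + n')"
proof (induction rule: box_induct)
  case (step r i j a)
  have "y ^ j * b \<in> box m' (j + n')"
    by (induction j) (use step y_mult_box in \<open>auto simp: mult.assoc\<close>)
  then have "x ^ i * (y ^ j * b) \<in> box (i + m') (j + n')"
    by (induction i) (use x_mult_box in \<open>auto simp: mult.assoc\<close>)
  then have "r *\<^sub>R (x ^ i * (y ^ j * b)) + a * b \<in> box (m + m') (n + n')"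
    using step by (intro box_closed) (auto elim!: box_mono)
  then show ?case by (simp add: algebra_simps)
qed (simp add: box_closed)

lemma box_one: "1 \<in> box m n"
  using box_base[of 0 m 0 n] by simp

lemma box_power: "a \<in> box m n \<Longrightarrow> a ^ k \<in> box (k * m) (k * n)"
  by (induction k) (auto intro: box_one box_mult)

lemma box_der_pow: "a \<in> box m n \<Longrightarrow> (der ^^ Suc n) a = 0"
proof (induction rule: box_induct)
  case (step r i j a)
  have x: "der (x ^ i) = 0" by (induction i) (auto simp: der_mult)
  have "(der ^^ Suc j) (y ^ j) = 0" by (simp add: der_pow_y_pow)
  then have "(der ^^ Suc n) (y ^ j) = 0" using der_pow_mono step by blast
  then show ?case using step by (simp add: der_pow_const_mult[OF x] del: funpow.simps)
qed simp

lemma box_zero_der: "a \<in> box m 0 \<Longrightarrow> der a = 0"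
  using box_der_pow[of a m 0] by simp

lemma box_zero_commute: "a \<in> box m 0 \<Longrightarrow> b \<in> box k 0 \<Longrightarrow> a * b = b * a"
proof (induction rule: box_induct)
  case (step r i j a)
  have "b * x = x * b" using box_zero_der[OF step.prems] by (simp add: der_def)
  then have "b * x ^ i = x ^ i * b"
    by (induction i) (auto simp: mult.assoc[symmetric] power_commutes, simp add: mult.assoc)
  with step show ?case by (simp add: algebra_simps)
qed simp

lemma box_split:
  assumes "a \<in> box m (Suc n)"
  obtains p a' where "p \<in> box m 0" "a' \<in> box m n" "a = p * y ^ Suc n + a'"
proof -
  have "\<exists>p a'. p \<in> box m 0 \<and> a' \<in> box m n \<and> a = p * y ^ Suc n + a'"
    using assms
  proof (induction rule: box_induct)
    case zero
    show ?case by (rule exI[of _ 0], rule exI[of _ 0]) (simp add: box_closed)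
  next
    case (step r i j a)
    then obtain p a' where p: "p \<in> box m 0" "a' \<in> box m n" "a = p * y ^ Suc n + a'" by blast
    show ?case
    proof (cases "j = Suc n")
      case True
      have "r *\<^sub>R x ^ i + p \<in> box m 0"
        using box_base[of i m 0 0] step.hyps p by (intro box_closed) auto
      then show ?thesis
        using True p by (intro exI[of _ "r *\<^sub>R x ^ i + p"] exI[of _ a']) (simp add: algebra_simps)
    next
      case False
      then have "r *\<^sub>R (x ^ i * y ^ j) + a' \<in> box m n"
        using step.hyps p by (intro box_closed box_base) auto
      then show ?thesis
        using p by (intro exI[of _ p] exI[of _ "r *\<^sub>R (x ^ i * y ^ j) + a'"]) (simp add: algebra_simps)
    qed
  qed
  then show ?thesis using that by blast
qed

text \<open>Applying \<open>der\<close> as often as the top power of \<open>y\<close> leaves only a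
  multiple of its coefficient \<open>p\<close>. Hence nilpotency of \<open>der\<close> bounds the
  degree in \<open>y\<close> without enlarging \<open>m\<close>.\<close>

lemma box_reduce: "a \<in> box m n \<Longrightarrow> (der ^^ Suc k) a = 0 \<Longrightarrow> a \<in> box m k"
proof (induction n)
  case 0
  then show ?case by (auto elim: box_mono)
next
  case (Suc n)
  show ?case
  proof (cases "Suc n \<le> k")
    case True
    with Suc.prems show ?thesis by (auto elim: box_mono)
  next
    case False
    obtain p a' where p: "p \<in> box m 0" "a' \<in> box m n" "a = p * y ^ Suc n + a'"
      using box_split Suc.prems(1) by blast
    have "(der ^^ Suc n) a = 0"
      using der_pow_mono[OF Suc.prems(2), of "Suc n"] False by (simp del: funpow.simps)
    then have "fact (Suc n) *\<^sub>R p = 0"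
      using p box_der_pow[OF p(2)]
      by (simp add: der_pow_const_mult[OF box_zero_der[OF p(1)]] der_pow_y_pow del: funpow.simps fact_Suc power_Suc)
    then have "p = 0" by (simp del: fact_Suc)
    with p Suc show ?thesis by simp
  qed
qed

lemma box_independent_card:
  assumes "finite F" "inj_on e F" "independent (e ` F)" "e ` F \<subseteq> box m n"
  shows "card F \<le> Suc m * Suc n"
proof -
  let ?B = "(\<lambda>(i, j). x ^ i * y ^ j) ` ({..m} \<times> {..n})"
  have "card (e ` F) \<le> card ?B"
    using independent_span_bound[of ?B "e ` F"] assms unfolding box_def by auto
  also have "\<dots> \<le> Suc m * Suc n"
    using card_image_le[of "{..m} \<times> {..n}" "\<lambda>(i, j). x ^ i * y ^ j"] by simp
  finally show ?thesis using card_image[OF assms(2)] by simp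
qed

end


section \<open>Leading terms\<close>

locale ring_valuation =
  fixes v :: "'a::ring_1 \<Rightarrow> 'g::linordered_group_add val"
  assumes valuation: "valuation v"
begin

lemma v_Infty [simp]: "v a = Infty \<longleftrightarrow> a = 0"
  and v_mult: "v (a * b) = v a + v b"
  and v_add: "min (v a) (v b) \<le> v (a + b)"
  using valuation unfolding valuation_def by auto

lemma v_zero [simp]: "v 0 = Infty"
  by simp

lemma v_one [simp]: "v 1 = 0"
proof -
  have "v 1 + v 1 = v 1 + 0" using v_mult[of 1 1] by simp
  then show ?thesis by (subst (asm) val_add_left_cancel) auto
qed

lemma v_minus [simp]: "v (- a) = v a"
proof -
  have "v (- 1) + v (- 1) = 0" using v_mult[of "- 1" "- 1"] by simp
  moreover have "v (- 1) < v (- 1) + v (- 1)" if "0 < v (- 1)"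
    using val_add_left_strict_mono[OF that, of "v (- 1)"] by simp
  moreover have "v (- 1) + v (- 1) < v (- 1)" if "v (- 1) < 0"
    using val_add_left_strict_mono[OF that, of "v (- 1)"] by simp
  ultimately have "v (- 1) = 0"
    by (metis linorder_neqE order_less_asym)
  then show ?thesis using v_mult[of "- 1" a] by simp
qed

lemma v_diff_commute: "v (a - b) = v (b - a)"
  by (metis minus_diff_eq v_minus)

lemma mult_nonzero [simp]: "(a :: 'a) * b = 0 \<longleftrightarrow> a = 0 \<or> b = 0"
  using v_mult[of a b] v_Infty by (metis val_add_eq_Infty)

lemma power_nonzero [simp]: "(a :: 'a) \<noteq> 0 \<Longrightarrow> a ^ n \<noteq> 0"
  by (induction n) auto

lemma less_v_add: "z < v a \<Longrightarrow> z < v b \<Longrightarrow> z < v (a + b)"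
  using v_add[of a b] by (meson less_le_trans min_less_iff_conj)

lemma less_v_diff: "z < v a \<Longrightarrow> z < v b \<Longrightarrow> z < v (a - b)"
  using less_v_add[of z a "- b"] by simp

lemma le_v_add: "z \<le> v a \<Longrightarrow> z \<le> v b \<Longrightarrow> z \<le> v (a + b)"
  using v_add[of a b] by (meson order_trans min.boundedI)

lemma v_add_eq: "v a < v b \<Longrightarrow> v (a + b) = v a"
  using v_add[of a b] less_v_diff[of "v a" "a + b" b] by (auto simp: not_less_iff_gr_or_eq min_def split: if_splits)
    (metis add_diff_cancel_right' less_irrefl less_le_not_le less_v_diff order_less_le)

lemma v_diff_eq: "v a < v b \<Longrightarrow> v (a - b) = v a"
  using v_add_eq[of a "- b"] by simp

text \<open>The relation written \<open>~\<close> above. The strict inequality makes it fail at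
  \<open>a = 0\<close>.\<close>

definition lead :: "'a \<Rightarrow> 'a \<Rightarrow> bool" where
  "lead a b \<longleftrightarrow> v a < v (a - b)"

lemma lead_nonzero: "lead a b \<Longrightarrow> a \<noteq> 0"
  by (auto simp: lead_def)

lemma lead_v: "lead a b \<Longrightarrow> v a = v b"
  using v_diff_eq[of a "a - b"] by (simp add: lead_def)

lemma lead_sym: "lead a b \<Longrightarrow> lead b a"
  using lead_v[of a b] v_diff_commute[of a b] by (simp add: lead_def)

lemma lead_trans: "lead a b \<Longrightarrow> lead b c \<Longrightarrow> lead a c"
  using lead_v[of a b] less_v_add[of "v a" "a - b" "b - c"] by (simp add: lead_def)

lemma lead_mult_left: "lead a b \<Longrightarrow> c \<noteq> 0 \<Longrightarrow> lead (c * a) (c * b)"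
  using val_add_left_strict_mono[of "v a" "v (a - b)" "v c"]
  by (simp add: lead_def v_mult flip: right_diff_distrib)

lemma lead_mult_right: "lead a b \<Longrightarrow> c \<noteq> 0 \<Longrightarrow> lead (a * c) (b * c)"
  using val_add_right_strict_mono[of "v a" "v (a - b)" "v c"]
  by (simp add: lead_def v_mult flip: left_diff_distrib)

lemma lead_refl: "a \<noteq> 0 \<Longrightarrow> lead a a"
  by (simp add: lead_def val_less_Infty_iff)

text \<open>The value group is not yet known to be abelian, so the tail of the product is replaced
  first and its head afterwards.\<close>

lemma v_power_less_power: "v a < v b \<Longrightarrow> b \<noteq> 0 \<Longrightarrow> 0 < n \<Longrightarrow> v (a ^ n) < v (b ^ n)"
proof (induction n)
  case (Suc n)
  have a: "a \<noteq> 0" using Suc.prems by auto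
  show ?case
  proof (cases "n = 0")
    case False
    then have "v a + v (a ^ n) < v a + v (b ^ n)" using Suc a by (intro val_add_left_strict_mono) auto
    also have "\<dots> < v b + v (b ^ n)" using Suc.prems by (intro val_add_right_strict_mono) auto
    finally show ?thesis by (simp add: v_mult)
  qed (use Suc in auto)
qed simp

lemma v_power_eq_power: "v (a ^ n) = v (b ^ n) \<Longrightarrow> 0 < n \<Longrightarrow> a \<noteq> 0 \<Longrightarrow> b \<noteq> 0 \<Longrightarrow> v a = v b"
  by (metis linorder_neqE less_irrefl v_power_less_power)

lemma v_power_le_power: "v (a ^ n) \<le> v (b ^ n) \<Longrightarrow> 0 < n \<Longrightarrow> a \<noteq> 0 \<Longrightarrow> b \<noteq> 0 \<Longrightarrow> v a \<le> v b"
  by (metis linorder_not_le v_power_less_power)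

lemma v_power_inj: "v (a ^ m) = v (a ^ n) \<Longrightarrow> a \<noteq> 0 \<Longrightarrow> v a \<noteq> 0 \<Longrightarrow> m = n"
proof (induction m n rule: linorder_wlog)
  case (le m n)
  have "v (a ^ n) = v (a ^ m) + v (a ^ (n - m))"
    using le.hyps by (simp flip: v_mult power_add)
  then have "v (a ^ m) + v (a ^ (n - m)) = v (a ^ m) + 0" using le.prems by simp
  then have "v (a ^ (n - m)) = v (1 ^ (n - m))"
    using le.prems by (subst (asm) val_add_left_cancel) auto
  then show ?case using v_power_eq_power[of a "n - m" 1] le by (cases "n - m") auto
qed simp

text \<open>A strict inequality between \<open>v a + v b\<close> and \<open>v b + v a\<close>
  persists when \<open>v b\<close> is moved past several copies of \<open>v a\<close>, so it would
  show for \<open>a ^ n\<close> as well.\<close>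

lemma commute_of_power:
  assumes "v (a ^ n) + v b = v b + v (a ^ n)" "0 < n"
  shows "v a + v b = v b + v a"
proof (cases "a = 0 \<or> b = 0")
  case False
  have less: "0 < n \<Longrightarrow> v (a ^ n) + v b < v b + v (a ^ n)" if "v a + v b < v b + v a" for n
  proof (induction n)
    case (Suc n)
    show ?case
    proof (cases "n = 0")
      case False
      have "v a + (v (a ^ n) + v b) < v a + (v b + v (a ^ n))"
        using Suc False \<open>\<not> (a = 0 \<or> b = 0)\<close> by (intro val_add_left_strict_mono) auto
      also have "\<dots> < (v b + v a) + v (a ^ n)"
        using that \<open>\<not> (a = 0 \<or> b = 0)\<close> unfolding add.assoc[symmetric]
        by (intro val_add_right_strict_mono) auto
      finally show ?thesis by (simp add: v_mult add.assoc)
    qed (use that in auto)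
  qed simp
  have greater: "0 < n \<Longrightarrow> v b + v (a ^ n) < v (a ^ n) + v b" if "v b + v a < v a + v b" for n
  proof (induction n)
    case (Suc n)
    show ?case
    proof (cases "n = 0")
      case False
      have "(v b + v a) + v (a ^ n) < (v a + v b) + v (a ^ n)"
        using that \<open>\<not> (a = 0 \<or> b = 0)\<close> by (intro val_add_right_strict_mono) auto
      also have "\<dots> = v a + (v b + v (a ^ n))" by (simp add: add.assoc)
      also have "\<dots> < v a + (v (a ^ n) + v b)"
        using Suc False \<open>\<not> (a = 0 \<or> b = 0)\<close> by (intro val_add_left_strict_mono) auto
      finally show ?thesis by (simp add: v_mult add.assoc)
    qed (use that in auto)
  qed simp
  show ?thesis using less[of n] greater[of n] assms by (metis less_irrefl linorder_neqE)
qed auto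

text \<open>Distinct values prevent cancellation. The membership yields linear independence, and the
  bound on each term serves for expansions in powers of one element.\<close>

lemma sum_distinct_values:
  assumes "finite F" "F \<noteq> {}" "inj_on (\<lambda>i. v (t i)) F"
  shows "v (sum t F) \<in> (\<lambda>i. v (t i)) ` F \<and> (\<forall>i\<in>F. v (sum t F) \<le> v (t i))"
  using assms
proof (induction F rule: finite_ne_induct)
  case (insert i F)
  then have IH: "v (sum t F) \<in> (\<lambda>i. v (t i)) ` F" "\<forall>i\<in>F. v (sum t F) \<le> v (t i)"
    by (auto simp: inj_on_def)
  have "v (t i) \<noteq> v (sum t F)"
    using IH(1) insert.prems insert.hyps by (auto simp: inj_on_def)
  then consider "v (t i) < v (sum t F)" | "v (sum t F) < v (t i)" by (meson linorder_neqE)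
  then show ?case
  proof cases
    case 1
    then have "v (sum t (insert i F)) = v (t i)" using insert.hyps v_add_eq by simp
    then show ?thesis using 1 IH by auto
  next
    case 2
    then have "v (sum t (insert i F)) = v (sum t F)"
      using insert.hyps v_add_eq[of "sum t F" "t i"] by (simp add: add.commute)
    then show ?thesis using 2 IH by auto
  qed
qed simp

end


text \<open>The second assumption is the residue field condition without division: \<open>r\<close>
  is the residue of \<open>a\<close> over \<open>b\<close>.\<close>

locale real_valuation = ring_valuation v
  for v :: "'a::real_algebra_1 \<Rightarrow> 'g::linordered_group_add val" +
  assumes trivial: "trivial_on_reals v"
    and residue: "v a = v b \<Longrightarrow> a \<noteq> 0 \<Longrightarrow> \<exists>r::real. v a < v (a - r *\<^sub>R b)"
begin

lemma v_of_real: "r \<noteq> 0 \<Longrightarrow> v (of_real r) = 0"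
  using trivial unfolding trivial_on_reals_def by blast

lemma v_scaleR [simp]: "r \<noteq> 0 \<Longrightarrow> v (r *\<^sub>R a) = v a"
  using v_mult[of "of_real r" a] by (simp add: scaleR_conv_of_real v_of_real)

lemma less_v_scaleR: "z < v a \<Longrightarrow> z < v (r *\<^sub>R a)"
  by (cases "r = 0") (auto simp: val_less_Infty_iff dest: less_imp_neq)

lemma lead_scaleR: "lead a b \<Longrightarrow> r \<noteq> 0 \<Longrightarrow> lead (r *\<^sub>R a) (r *\<^sub>R b)"
  by (simp add: lead_def flip: scaleR_diff_right)

lemma lead_exists:
  assumes "v a = v b" "a \<noteq> 0"
  obtains r where "r \<noteq> 0" "lead a (r *\<^sub>R b)"
proof -
  obtain r where "v a < v (a - r *\<^sub>R b)" using residue assms by blast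
  then show ?thesis using that[of r] by (cases "r = 0") (auto simp: lead_def)
qed

lemma lead_unique: "lead a (r *\<^sub>R b) \<Longrightarrow> lead a (s *\<^sub>R b) \<Longrightarrow> r = s"
proof (rule ccontr)
  assume a: "lead a (r *\<^sub>R b)" "lead a (s *\<^sub>R b)" "r \<noteq> s"
  have "v a < v ((a - r *\<^sub>R b) - (a - s *\<^sub>R b))"
    using a(1,2) unfolding lead_def by (rule less_v_diff)
  also have "(a - r *\<^sub>R b) - (a - s *\<^sub>R b) = (s - r) *\<^sub>R b" by (simp add: algebra_simps)
  finally have "v a < v b" using a by simp
  moreover have "r \<noteq> 0" using a(1) lead_nonzero[OF a(1)] by (auto simp: lead_def)
  ultimately show False using lead_v[OF a(1)] by simp
qed

text \<open>Nonzero real factors keep values, so the nonzero terms of a vanishing combination would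
  have distinct values and could not cancel.\<close>

lemma distinct_values_independent:
  assumes "finite F" "\<And>i. i \<in> F \<Longrightarrow> e i \<noteq> 0" "inj_on (\<lambda>i. v (e i)) F"
  shows "inj_on e F" "independent (e ` F)"
proof -
  show inj: "inj_on e F" using assms(3) by (auto simp: inj_on_def)
  show "independent (e ` F)"
  proof (rule independent_if_scalars_zero)
    fix f u assume sum: "(\<Sum>u\<in>e ` F. f u *\<^sub>R u) = 0" and u: "u \<in> e ` F"
    show "f u = 0"
    proof (rule ccontr)
      assume "f u \<noteq> 0"
      define G where "G = {i \<in> F. f (e i) \<noteq> 0}"
      have G: "finite G" "G \<noteq> {}" using assms(1) u \<open>f u \<noteq> 0\<close> by (auto simp: G_def)
      have inj': "inj_on (\<lambda>i. v (f (e i) *\<^sub>R e i)) G"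
        using assms(3) by (auto simp: G_def inj_on_def)
      have "0 = (\<Sum>i\<in>F. f (e i) *\<^sub>R e i)" using sum sum.reindex[OF inj, of "\<lambda>u. f u *\<^sub>R u"] by (simp add: o_def)
      also have "\<dots> = (\<Sum>i\<in>G. f (e i) *\<^sub>R e i)"
        using assms(1) by (intro sum.mono_neutral_right) (auto simp: G_def)
      finally have "v 0 \<in> (\<lambda>i. v (f (e i) *\<^sub>R e i)) ` G"
        using sum_distinct_values[OF G inj'] by simp
      then obtain i where "i \<in> G" "e i = 0" by (auto simp: G_def image_iff) (metis v_Infty)
      then show False using assms(2) by (simp add: G_def)
    qed
  qed (use assms in auto)
qed

end


section \<open>Values of the Weyl algebra\<close>

text \<open>As ordered groups are torsion-free, \<open>v x \<noteq> 0\<close> gives distinct powers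
  of \<open>x\<close> distinct values.\<close>

locale weyl_valuation = weyl_pair x y + real_valuation v
  for x y :: "'a::real_algebra_1" and v :: "'a \<Rightarrow> 'g::linordered_group_add val" +
  assumes generated: "\<exists>m n. a \<in> box m n"
    and v_x: "v x \<noteq> 0" and x_nonzero [simp]: "x \<noteq> 0"
begin

section \<open>Commutation with \<open>x\<close> up to higher value\<close>

lemma der_nilpotent: "\<exists>n. (der ^^ n) a = 0"
  using generated box_der_pow by blast

text \<open>If \<open>a\<close> failed to commute with \<open>x\<close> up to higher order terms, so would \<open>der a\<close>; but \<open>der\<close> is
  locally nilpotent.\<close>

lemma not_lead_der:
  assumes a: "a \<noteq> 0" and nl: "\<not> lead (a * x) (x * a)"
  shows "der a \<noteq> 0 \<and> \<not> lead (der a * x) (x * der a)"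
proof (cases "v (a * x) = v (x * a)")
  case False
  \<comment> \<open>\<open>der a\<close> takes the smaller of the two values, and its products with
    \<open>x\<close> then differ in value again.\<close>
  then consider "v (a * x) < v (x * a)" | "v (x * a) < v (a * x)" by (meson linorder_neqE)
  then have "v (der a) \<noteq> Infty \<and> v (der a * x) \<noteq> v (x * der a)"
  proof cases
    case 1
    then have d: "v (der a) = v a + v x" using v_diff_eq[of "a * x" "x * a"] by (simp add: der_def v_mult)
    have "(v a + v x) + v x < (v x + v a) + v x"
      using 1 by (intro val_add_right_strict_mono) (auto simp: v_mult)
    then show ?thesis using d a by (auto simp: v_mult add.assoc)
  next
    case 2
    then have d: "v (der a) = v x + v a"
      using v_diff_eq[of "x * a" "a * x"] by (simp add: der_def v_mult v_diff_commute)
    have "v x + (v x + v a) < v x + (v a + v x)"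
      using 2 by (intro val_add_left_strict_mono) (auto simp: v_mult)
    then show ?thesis using d a by (auto simp: v_mult add.assoc)
  qed
  then show ?thesis using lead_v by auto
next
  case True
  then have va: "v a + v x = v x + v a" by (simp add: v_mult)
  have ge: "v (a * x) \<le> v (der a)"
    using v_add[of "a * x" "- (x * a)"] True by (simp add: der_def)
  then have d: "v (der a) = v (a * x)" using nl by (auto simp: lead_def der_def)
  then have nz: "der a \<noteq> 0" using a v_Infty[of "der a"] by (auto simp: v_mult)
  \<comment> \<open>The ratio \<open>r\<close> is not 1, and \<open>der (der a)\<close> is
    \<open>(r - 1) *\<^sub>R (x * der a)\<close> plus \<open>der \<epsilon>\<close>. Leading
    commutation of \<open>der a\<close> with \<open>x\<close> would make \<open>der (der a)\<close>
    and \<open>der \<epsilon>\<close> both too large in value.\<close>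
  obtain r where r: "v (a * x) < v (a * x - r *\<^sub>R (x * a))"
    using residue[OF True] a by auto
  define \<epsilon> where "\<epsilon> = a * x - r *\<^sub>R (x * a)"
  have r1: "r \<noteq> 1" using r nl by (auto simp: lead_def)
  have da: "der a = (r - 1) *\<^sub>R (x * a) + \<epsilon>" by (simp add: der_def \<epsilon>_def algebra_simps)
  have dda: "der (der a) = (r - 1) *\<^sub>R (x * der a) + der \<epsilon>"
    by (subst da) (simp add: der_mult)
  have "\<not> lead (der a * x) (x * der a)"
  proof
    assume "lead (der a * x) (x * der a)"
    then have 1: "v (der a * x) < v (der (der a))" by (simp add: lead_def der_def)
    have e: "v (der a) < v \<epsilon>" using r d by (simp add: \<epsilon>_def)
    have eq: "v (x * der a) = v (der a * x)"
      using va by (simp add: v_mult d) (metis add.assoc)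
    have "v (der a) + v x < v \<epsilon> + v x" "v x + v (der a) < v x + v \<epsilon>"
      using e by (auto intro: val_add_left_strict_mono val_add_right_strict_mono)
    then have "v (der a * x) < v (\<epsilon> * x)" "v (der a * x) < v (x * \<epsilon>)"
      using eq by (auto simp: v_mult)
    then have "v (der a * x) < v (der \<epsilon>)"
      unfolding der_def[of \<epsilon>] by (rule less_v_diff)
    then have "v (der a * x) < v (der (der a) - der \<epsilon>)" using 1 by (intro less_v_diff)
    also have "\<dots> = v (x * der a)" using r1 by (simp add: dda)
    finally show False using eq by simp
  qed
  with nz show ?thesis by blast
qed

lemma lead_x: "a \<noteq> 0 \<Longrightarrow> lead (a * x) (x * a)"
proof (rule ccontr)
  assume a: "a \<noteq> 0" "\<not> lead (a * x) (x * a)"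
  have "(der ^^ n) a \<noteq> 0 \<and> \<not> lead ((der ^^ n) a * x) (x * (der ^^ n) a)" for n
    using a by (induction n) (use not_lead_der in auto)
  then show False using der_nilpotent by blast
qed

lemma v_x_commute: "v a + v x = v x + v a"
  using lead_v[OF lead_x, of a] by (cases "a = 0") (auto simp: v_mult)

lemma v_der_gt: "a \<noteq> 0 \<Longrightarrow> v a + v x < v (der a)"
  using lead_x[of a] by (simp add: lead_def der_def v_mult)

section \<open>Dependence of values from quadratic growth\<close>

lemma value_collision:
  assumes "\<And>i. i \<in> F \<Longrightarrow> e i \<noteq> 0" "e ` F \<subseteq> box m n" "finite F" "Suc m * Suc n < card F"
  obtains i j where "i \<in> F" "j \<in> F" "i \<noteq> j" "v (e i) = v (e j)"
proof -
  have "\<not> inj_on (\<lambda>i. v (e i)) F"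
    using distinct_values_independent[of F e] box_independent_card[of F e m n] assms by auto
  then show ?thesis using that by (auto simp: inj_on_def)
qed

text \<open>Monomials with exponents up to \<open>N\<close> are cubically many, but they lie in a
  box whose dimension grows at most quadratically in \<open>N\<close>.\<close>

lemma monomial_collision:
  assumes nz: "a \<noteq> 0" "b \<noteq> 0" "c \<noteq> 0"
  obtains i j k i' j' k' where "(i, j, k) \<noteq> (i', j', k')"
    "v (a ^ i * b ^ j * c ^ k) = v (a ^ i' * b ^ j' * c ^ k')"
proof -
  obtain C where C: "a \<in> box C C" "b \<in> box C C" "c \<in> box C C"
  proof -
    obtain m1 n1 m2 n2 m3 n3 where *: "a \<in> box m1 n1" "b \<in> box m2 n2" "c \<in> box m3 n3"
      using generated by metis
    show ?thesis
      using *[THEN box_mono, of "m1 + n1 + m2 + n2 + m3 + n3" "m1 + n1 + m2 + n2 + m3 + n3"]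
      by (intro that[of "m1 + n1 + m2 + n2 + m3 + n3"]) simp_all
  qed
  \<comment> \<open>Chosen so that the bound
    \<open>(3 * Suc N * Suc C) * (3 * Suc N * Suc C)\<close> on the dimension equals
    \<open>N * (Suc N * Suc N)\<close>, less than the number of monomials.\<close>
  define N where "N = 9 * Suc C * Suc C"
  let ?F = "{..N} \<times> {..N} \<times> {..N}" and ?e = "\<lambda>(i, j, k). a ^ i * b ^ j * c ^ k"
  have "Suc (3 * N * C) \<le> 3 * Suc N * Suc C" by (simp add: algebra_simps)
  then have "Suc (3 * N * C) * Suc (3 * N * C) \<le> (3 * Suc N * Suc C) * (3 * Suc N * Suc C)"
    by (intro mult_le_mono)
  also have "(3 * p * q) * (3 * p * q) = (9 * q * q) * (p * p)" for p q :: nat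
    by simp
  also have "(9 * Suc C * Suc C) * (Suc N * Suc N) = N * (Suc N * Suc N)" by (simp only: N_def)
  also have "\<dots> < card ?F" by (simp add: card_cartesian_product)
  finally have card: "Suc (3 * N * C) * Suc (3 * N * C) < card ?F" .
  have box: "a ^ i * b ^ j * c ^ k \<in> box (3 * N * C) (3 * N * C)" if "i \<le> N" "j \<le> N" "k \<le> N" for i j k
  proof (rule box_mono)
    show "a ^ i * b ^ j * c ^ k \<in> box (i * C + j * C + k * C) (i * C + j * C + k * C)"
      using C by (intro box_mult box_power)
    have "i * C \<le> N * C" "j * C \<le> N * C" "k * C \<le> N * C" using that by (auto intro: mult_le_mono)
    then show "i * C + j * C + k * C \<le> 3 * N * C" "i * C + j * C + k * C \<le> 3 * N * C" by linarith+
  qed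
  obtain s t where "s \<in> ?F" "t \<in> ?F" "s \<noteq> t" "v (?e s) = v (?e t)"
  proof (rule value_collision[of ?F ?e "3 * N * C" "3 * N * C"])
    show "?e s \<noteq> 0" for s using nz by (simp add: split_beta)
    show "?e ` ?F \<subseteq> box (3 * N * C) (3 * N * C)" using box by auto
    show "finite ?F" by simp
    show "Suc (3 * N * C) * Suc (3 * N * C) < card ?F" by (rule card)
  qed
  then show ?thesis using that by (simp add: split_beta prod_eq_iff)
qed

text \<open>A dependence among \<open>v a\<close>, \<open>v b\<close> and the central
  \<open>v x\<close> expresses a positive multiple of \<open>v a\<close> by \<open>v b\<close> and
  \<open>v x\<close>, or one of \<open>v b\<close> by \<open>v x\<close>. So some power commutes,
  and \<open>commute_of_power\<close> removes the exponent.\<close>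

lemma v_commute: "v a + v b = v b + v a"
proof (cases "a = 0 \<or> b = 0")
  case False
  then have nz: "a \<noteq> 0" "b \<noteq> 0" by auto
  obtain i j k i' j' k' where ne: "(i, j, k) \<noteq> (i', j', k')"
    and eq: "v (a ^ i * b ^ j * x ^ k) = v (a ^ i' * b ^ j' * x ^ k')"
    by (rule monomial_collision[OF nz x_nonzero])
  have pow: "v c + v (d ^ n) = v (d ^ n) + v c" if "v c + v d = v d + v c" for c d n
  proof (induction n)
    case (Suc n)
    have "v c + v (d ^ Suc n) = (v c + v d) + v (d ^ n)" by (simp add: v_mult add.assoc)
    also have "\<dots> = v d + (v c + v (d ^ n))" by (simp only: that add.assoc)
    also have "\<dots> = v (d ^ Suc n) + v c" by (simp add: Suc v_mult add.assoc)
    finally show ?case .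
  qed simp
  have x: "v c + v (x ^ n) = v (x ^ n) + v c" for c n by (rule pow[OF v_x_commute])
  have comm: "v c + v d = v d + v c"
    if "v (c ^ p) + Z = Z'" "0 < p" "Z + v d = v d + Z" "Z' + v d = v d + Z'" "Z \<noteq> Infty" for c d p Z Z'
  proof (rule commute_of_power)
    have "v (c ^ p) + v d + Z = v (c ^ p) + Z + v d" using that by (metis add.assoc)
    also have "\<dots> = v d + v (c ^ p) + Z" using that by (simp add: add.assoc)
    finally show "v (c ^ p) + v d = v d + v (c ^ p)"
      using val_add_right_cancel[OF that(5)] by blast
  qed (rule that)
  have split: "v (c ^ i) = v (c ^ i') + v (c ^ (i - i'))" if "i' \<le> i" for c and i i' :: nat
    using that by (simp flip: v_mult power_add)
  have bx: "(v (b ^ j) + v (x ^ k)) + v b = v b + (v (b ^ j) + v (x ^ k))" for j k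
    using x[of b k] pow[of b b j] by (metis add.assoc)
  have xa: "v (x ^ k) + v a = v a + v (x ^ k)" for k by (simp add: x)
  have eq': "v (a ^ i) + (v (b ^ j) + v (x ^ k)) = v (a ^ i') + (v (b ^ j') + v (x ^ k'))"
    using eq by (simp add: v_mult add.assoc)
  consider "i' < i" | "i < i'" | "i = i'" "j' < j" | "i = i'" "j < j'" | "i = i'" "j = j'" "k \<noteq> k'"
    using ne by (cases i i' rule: linorder_cases; cases j j' rule: linorder_cases) auto
  then show ?thesis
  proof cases
    case 1
    then have "v (a ^ (i - i')) + (v (b ^ j) + v (x ^ k)) = v (b ^ j') + v (x ^ k')"
      using eq' split[of i' i a] False val_add_left_cancel[of "v (a ^ i')"] by (simp add: add.assoc)
    then show ?thesis by (rule comm) (use 1 nz bx in simp_all)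
  next
    case 2
    then have "v (a ^ (i' - i)) + (v (b ^ j') + v (x ^ k')) = v (b ^ j) + v (x ^ k)"
      using eq' split[of i i' a] False val_add_left_cancel[of "v (a ^ i)"] by (simp add: add.assoc)
    then show ?thesis by (rule comm) (use 2 nz bx in simp_all)
  next
    case 3
    then have "v (b ^ (j - j')) + v (x ^ k) = v (x ^ k')"
      using eq' split[of j' j b] False val_add_left_cancel[of "v (a ^ i)"] val_add_left_cancel[of "v (b ^ j')"]
      by (simp add: add.assoc)
    then have "v b + v a = v a + v b" by (rule comm) (use 3 xa in simp_all)
    then show ?thesis by simp
  next
    case 4
    then have "v (b ^ (j' - j)) + v (x ^ k') = v (x ^ k)"
      using eq' split[of j j' b] False val_add_left_cancel[of "v (a ^ i)"] val_add_left_cancel[of "v (b ^ j)"]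
      by (simp add: add.assoc)
    then have "v b + v a = v a + v b" by (rule comm) (use 4 xa in simp_all)
    then show ?thesis by simp
  next
    case 5
    then have "v (x ^ k) = v (x ^ k')"
      using eq' False val_add_left_cancel[of "v (a ^ i)"] val_add_left_cancel[of "v (b ^ j)"] by simp
    then show ?thesis using v_power_inj v_x 5 by auto
  qed
qed auto

lemma v_left_commute: "v a + (v b + z) = v b + (v a + z)"
  by (metis add.assoc v_commute)

lemmas v_ac = add.assoc v_commute v_left_commute

end


section \<open>The commutation sign\<close>

context weyl_valuation
begin

text \<open>The sign \<open>\<lambda>\<close> of the introduction, meaningful for nonzero arguments
  only.\<close>

definition comm :: "'a \<Rightarrow> 'a \<Rightarrow> real" where
  "comm a b = (THE r. lead (a * b) (r *\<^sub>R (b * a)))"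

lemma comm_eqI: "lead (a * b) (r *\<^sub>R (b * a)) \<Longrightarrow> comm a b = r"
  unfolding comm_def by (rule the_equality) (auto intro: lead_unique)

lemma lead_comm:
  assumes "a \<noteq> 0" "b \<noteq> 0"
  shows "lead (a * b) (comm a b *\<^sub>R (b * a))" "comm a b \<noteq> 0"
proof -
  obtain r where "r \<noteq> 0" "lead (a * b) (r *\<^sub>R (b * a))"
    using lead_exists[of "a * b" "b * a"] assms v_commute[of a b] by (auto simp: v_mult)
  then show "lead (a * b) (comm a b *\<^sub>R (b * a))" "comm a b \<noteq> 0" using comm_eqI by auto
qed

lemma comm_self: "a \<noteq> 0 \<Longrightarrow> comm a a = 1"
  by (intro comm_eqI) (simp add: lead_refl)

lemma comm_one: "a \<noteq> 0 \<Longrightarrow> comm a 1 = 1"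
  by (intro comm_eqI) (simp add: lead_refl)

lemma comm_x: "a \<noteq> 0 \<Longrightarrow> comm a x = 1"
  by (intro comm_eqI) (simp add: lead_x)

lemma comm_mult_right:
  assumes "a \<noteq> 0" "b \<noteq> 0" "c \<noteq> 0"
  shows "comm a (b * c) = comm a b * comm a c"
proof (rule comm_eqI)
  have "lead (a * (b * c)) (comm a b *\<^sub>R (b * (a * c)))"
    using lead_mult_right[OF lead_comm(1)[OF assms(1,2)] assms(3)] by (simp add: mult.assoc)
  moreover have "lead (comm a b *\<^sub>R (b * (a * c))) (comm a b *\<^sub>R (b * (comm a c *\<^sub>R (c * a))))"
    using assms by (intro lead_scaleR lead_mult_left lead_comm)
  ultimately show "lead (a * (b * c)) ((comm a b * comm a c) *\<^sub>R (b * c * a))"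
    using lead_trans by (simp add: mult.assoc)
qed

lemma comm_swap:
  assumes "a \<noteq> 0" "b \<noteq> 0"
  shows "comm b a = inverse (comm a b)"
proof (rule comm_eqI)
  have "lead (inverse (comm a b) *\<^sub>R (a * b)) (inverse (comm a b) *\<^sub>R comm a b *\<^sub>R (b * a))"
    using lead_comm[OF assms] by (intro lead_scaleR) auto
  from lead_sym[OF this] show "lead (b * a) (inverse (comm a b) *\<^sub>R (a * b))"
    using lead_comm(2)[OF assms] by simp
qed

lemma comm_power_right: "a \<noteq> 0 \<Longrightarrow> b \<noteq> 0 \<Longrightarrow> comm a (b ^ n) = comm a b ^ n"
  by (induction n) (auto simp: comm_one comm_mult_right)

text \<open>\<open>b\<close> is a real multiple of \<open>b'\<close> up to \<open>~\<close>, and the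
  scalar cancels. Relations between values thus become relations between signs.\<close>

lemma comm_cong_right:
  assumes "v b = v b'" "a \<noteq> 0" "b \<noteq> 0"
  shows "comm a b = comm a b'"
proof -
  have b': "b' \<noteq> 0" using assms v_Infty by metis
  obtain r where r: "r \<noteq> 0" "lead b (r *\<^sub>R b')" using lead_exists assms by metis
  have "lead (a * b) (comm a b' *\<^sub>R (b * a))"
  proof (rule lead_trans)
    show "lead (a * b) (r *\<^sub>R (a * b'))" using lead_mult_left[OF r(2) assms(2)] by simp
    have "lead (r *\<^sub>R (a * b')) (r *\<^sub>R comm a b' *\<^sub>R (b' * a))"
      using r assms b' by (intro lead_scaleR lead_comm)
    moreover have "lead (comm a b' *\<^sub>R (r *\<^sub>R b' * a)) (comm a b' *\<^sub>R (b * a))"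
      using lead_comm(2)[OF assms(2) b'] lead_sym[OF r(2)] assms(2)
      by (intro lead_scaleR lead_mult_right)
    ultimately show "lead (r *\<^sub>R (a * b')) (comm a b' *\<^sub>R (b * a))"
      using lead_trans by (simp add: mult.commute)
  qed
  then show ?thesis by (rule comm_eqI)
qed

lemma comm_power_cases: "a \<noteq> 0 \<Longrightarrow> b \<noteq> 0 \<Longrightarrow> comm a b ^ m = comm a b ^ n \<Longrightarrow> m \<noteq> n \<Longrightarrow>
    comm a b = 1 \<or> comm a b = - 1"
proof (induction m n rule: linorder_wlog)
  case (le m n)
  have "comm a b ^ m * comm a b ^ (n - m) = comm a b ^ (m + (n - m))"
    by (rule power_add[symmetric])
  then have "comm a b ^ m * comm a b ^ (n - m) = comm a b ^ m * 1"
    using le by simp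
  then have "comm a b ^ (n - m) = 1" using lead_comm(2)[of a b] le by simp
  then have "\<bar>comm a b\<bar> = 1" using power_eq_1_iff[of "comm a b" "n - m"] le by auto
  then show ?case by linarith
qed auto

text \<open>Pairing a dependence among \<open>a\<close>, \<open>b\<close>, \<open>x\<close> with
  \<open>a\<close> removes the factors from \<open>a\<close> and \<open>x\<close> and equates two
  powers of \<open>comm a b\<close>; a nonzero real with two equal powers is 1 or -1. If the
  exponents of \<open>b\<close> agree, \<open>b\<close> is paired instead.\<close>

lemma comm_cases:
  assumes nz: "a \<noteq> 0" "b \<noteq> 0"
  shows "comm a b = 1 \<or> comm a b = - 1"
proof -
  obtain i j k i' j' k' where ne: "(i, j, k) \<noteq> (i', j', k')"
    and eq: "v (a ^ i * b ^ j * x ^ k) = v (a ^ i' * b ^ j' * x ^ k')"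
    by (rule monomial_collision[OF nz x_nonzero])
  have "comm c (a ^ i * b ^ j * x ^ k) = comm c (a ^ i' * b ^ j' * x ^ k')" if "c \<noteq> 0" for c
    using eq that nz by (intro comm_cong_right) auto
  then have *: "comm c a ^ i * comm c b ^ j = comm c a ^ i' * comm c b ^ j'" if "c \<noteq> 0" for c
    using that nz by (simp add: comm_mult_right comm_power_right comm_x)
  consider "j \<noteq> j'" | "i \<noteq> i'" | "i = i'" "j = j'" "k \<noteq> k'" using ne by auto
  then show ?thesis
  proof cases
    case 1
    then show ?thesis using *[OF nz(1)] nz comm_power_cases by (simp add: comm_self)
  next
    case 2
    then have "comm b a = 1 \<or> comm b a = - 1"
      using *[OF nz(2)] nz comm_power_cases[of b a i i'] by (simp add: comm_self)
    then show ?thesis using comm_swap[of b a] nz by auto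
  next
    case 3
    then have "v (x ^ k) = v (x ^ k')"
      using eq nz val_add_left_cancel[of "v (a ^ i)"] val_add_left_cancel[of "v (b ^ j)"]
      by (simp add: v_mult add.assoc)
    then show ?thesis using v_power_inj v_x 3 by auto
  qed
qed

text \<open>Since values are torsion-free, a dependence between \<open>v a\<close> and \<open>v b\<close> can be divided by two until
  one of the exponents in it is odd.\<close>

lemma comm_dependent:
  assumes nz: "a \<noteq> 0" "b \<noteq> 0"
  shows "v (a ^ p * b ^ q) = v (a ^ p' * b ^ q') \<Longrightarrow> (p, q) \<noteq> (p', q') \<Longrightarrow> comm a b = 1"
proof (induction "p + q + p' + q'" arbitrary: p q p' q' rule: less_induct)
  case less
  have "comm c (a ^ p * b ^ q) = comm c (a ^ p' * b ^ q')" if "c \<noteq> 0" for c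
    using less.prems(1) that nz by (intro comm_cong_right) auto
  then have *: "comm c a ^ p * comm c b ^ q = comm c a ^ p' * comm c b ^ q'" if "c \<noteq> 0" for c
    using that nz by (simp add: comm_mult_right comm_power_right)
  have a: "comm a b ^ q = comm a b ^ q'" using *[OF nz(1)] nz by (simp add: comm_self)
  have b: "comm b a ^ p = comm b a ^ p'" using *[OF nz(2)] nz by (simp add: comm_self)
  show ?case
  proof (rule ccontr)
    assume "comm a b \<noteq> 1"
    then have ab: "comm a b = - 1" "comm b a = - 1"
      using comm_cases[OF nz] comm_swap[OF nz] by auto
    have par: "even p \<longleftrightarrow> even p'" "even q \<longleftrightarrow> even q'"
      using a b unfolding ab by (auto simp: minus_one_power_iff split: if_splits)
    show False
    \<comment> \<open>Common factors are cancelled first. Without any, each pair of exponents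
      contains a zero, so equal parity makes all four even.\<close>
    proof (cases "0 < p \<and> 0 < p' \<or> 0 < q \<and> 0 < q'")
      case True
      then show False
      proof
        assume "0 < p \<and> 0 < p'"
        then obtain m m' where m: "p = Suc m" "p' = Suc m'" by (auto simp: gr0_conv_Suc)
        then have "v (a ^ m * b ^ q) = v (a ^ m' * b ^ q')"
          using less.prems(1) nz val_add_left_cancel[of "v a"] by (simp add: v_mult add.assoc)
        then show False using less.hyps[of m q m' q'] m less.prems(2) ab by simp
      next
        assume "0 < q \<and> 0 < q'"
        then obtain m m' where m: "q = Suc m" "q' = Suc m'" by (auto simp: gr0_conv_Suc)
        then have "v (a ^ p * b ^ m) = v (a ^ p' * b ^ m')"
          using less.prems(1) nz val_add_right_cancel[of "v b"]
          by (simp add: v_mult flip: add.assoc mult.assoc power_Suc2 del: power_Suc)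
            (simp add: power_Suc2 v_mult del: power_Suc flip: add.assoc)
        then show False using less.hyps[of p m p' m'] m less.prems(2) ab by simp
      qed
    next
      case False
      then have "even p" "even q" "even p'" "even q'" using par by auto
      then obtain s t s' t' where st: "p = 2 * s" "q = 2 * t" "p' = 2 * s'" "q' = 2 * t'"
        by (auto elim!: evenE)
      have sq: "v ((a ^ s * b ^ t) ^ 2) = v (a ^ (2 * s) * b ^ (2 * t))" for s t
        by (simp add: v_mult power2_eq_square mult_2 power_add v_ac)
      have "v (a ^ s * b ^ t) = v (a ^ s' * b ^ t')"
        by (rule v_power_eq_power[of _ 2]) (use less.prems nz in \<open>simp_all only: sq flip: st, simp_all\<close>)
      moreover have "s + t + s' + t' \<noteq> 0" using st less.prems(2) by auto
      ultimately show False using less.hyps[of s t s' t'] st less.prems(2) ab by auto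
    qed
  qed
qed

text \<open>\<open>v a\<close> is a rational multiple of \<open>v x\<close>; two exponents on
  \<open>x\<close> stand for one integer.\<close>

definition x_torsion :: "'a \<Rightarrow> bool" where
  "x_torsion a \<longleftrightarrow> (\<exists>n>0. \<exists>k l. v (a ^ n * x ^ k) = v (x ^ l))"

lemma v_power_mult: "v ((a * b) ^ n) = v (a ^ n) + v (b ^ n)"
  by (induction n) (auto simp: v_mult v_ac)

lemma v_power_cong: "v a = v b \<Longrightarrow> v (a ^ n) = v (b ^ n)"
  by (induction n) (auto simp: v_mult)

text \<open>Eliminating \<open>v x\<close> from the two relations leaves a dependence for
  \<open>comm_dependent\<close>.\<close>

lemma comm_x_torsion:
  assumes nz: "f \<noteq> 0" "b \<noteq> 0" and "x_torsion f" "x_torsion b"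
  shows "comm f b = 1"
proof -
  obtain n k l m k' l' where n: "0 < n" "v (f ^ n * x ^ k) = v (x ^ l)"
    and m: "0 < m" "v (b ^ m * x ^ k') = v (x ^ l')"
    using assms unfolding x_torsion_def by blast
  have F: "v (f ^ (n * i)) + v (x ^ (k * i)) = v (x ^ (l * i))" for i
    using v_power_cong[OF n(2), of i] by (simp add: v_power_mult flip: power_mult)
  have B: "v (b ^ (m * i)) + v (x ^ (k' * i)) = v (x ^ (l' * i))" for i
    using v_power_cong[OF m(2), of i] by (simp add: v_power_mult flip: power_mult)
  show ?thesis
  proof (cases "k = l \<and> k' = l'")
    \<comment> \<open>Elimination would give a trivial relation here, but then \<open>f ^ n\<close>
      itself has value zero.\<close>
    case True
    then have "v (f ^ n) + v (x ^ k) = 0 + v (x ^ k)" using n by (simp add: v_mult)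
    then have "v (f ^ n * b ^ 0) = v (f ^ 0 * b ^ 0)" by (subst (asm) val_add_right_cancel) auto
    then show ?thesis using comm_dependent[OF nz, of n 0 0 0] n(1) by auto
  next
    case False
    have "v (f ^ (n * k') * b ^ (m * l)) + v (x ^ (k * k')) + v (x ^ (k' * l))
        = (v (f ^ (n * k')) + v (x ^ (k * k'))) + (v (b ^ (m * l)) + v (x ^ (k' * l)))"
      by (simp only: v_mult v_ac)
    also have "\<dots> = v (x ^ (l' * l)) + v (x ^ (k' * l))"
      unfolding F B by (simp add: mult.commute v_commute)
    finally have 1: "v (f ^ (n * k') * b ^ (m * l)) + v (x ^ (k * k')) = v (x ^ (l' * l))"
      by (subst (asm) val_add_right_cancel) auto
    have "v (f ^ (n * l') * b ^ (m * k)) + v (x ^ (k * k')) + v (x ^ (k * l'))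
        = (v (f ^ (n * l')) + v (x ^ (k * l'))) + (v (b ^ (m * k)) + v (x ^ (k' * k)))"
      by (simp only: v_mult v_ac mult.commute[of k k'])
    also have "\<dots> = v (x ^ (l' * l)) + v (x ^ (k * l'))"
      unfolding F B by (simp add: mult.commute)
    finally have 2: "v (f ^ (n * l') * b ^ (m * k)) + v (x ^ (k * k')) = v (x ^ (l' * l))"
      by (subst (asm) val_add_right_cancel) auto
    have "v (f ^ (n * k') * b ^ (m * l)) = v (f ^ (n * l') * b ^ (m * k))"
      using 1 unfolding 2[symmetric] by (subst (asm) val_add_right_cancel) auto
    then show ?thesis using comm_dependent[OF nz] False n(1) m(1) by auto
  qed
qed

text \<open>\<open>i - j\<close> times \<open>v b\<close> is the difference of \<open>v a'\<close>
  and \<open>v a\<close>. This will separate the values of the terms in an expansion in powers of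
  \<open>b\<close>.\<close>

lemma x_torsion_quotient:
  assumes "a \<noteq> 0" "a' \<noteq> 0" "b \<noteq> 0" "x_torsion a" "x_torsion a'"
    and eq: "v (a * b ^ i) = v (a' * b ^ j)" and "j < i"
  shows "x_torsion b"
proof -
  obtain n k l m k' l' where n: "0 < n" "v (a ^ n * x ^ k) = v (x ^ l)"
    and m: "0 < m" "v (a' ^ m * x ^ k') = v (x ^ l')"
    using assms unfolding x_torsion_def by blast
  have A: "v (a ^ (n * m)) + v (x ^ (k * m)) = v (x ^ (l * m))"
    using v_power_cong[OF n(2), of m] by (simp add: v_power_mult flip: power_mult)
  have A': "v (a' ^ (n * m)) + v (x ^ (k' * n)) = v (x ^ (l' * n))"
    using v_power_cong[OF m(2), of n] by (simp add: v_power_mult mult.commute flip: power_mult)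
  have "v (b ^ i) = v (b ^ (i - j)) + v (b ^ j)"
    using \<open>j < i\<close> by (simp flip: v_mult power_add)
  then have "(v a + v (b ^ (i - j))) + v (b ^ j) = v a' + v (b ^ j)"
    using eq by (simp add: v_mult add.assoc)
  then have "v (a * b ^ (i - j)) = v a'"
    using assms by (subst (asm) val_add_right_cancel) (auto simp: v_mult)
  from v_power_cong[OF this, of "n * m"]
  have "v (a ^ (n * m)) + v (b ^ ((i - j) * (n * m))) = v (a' ^ (n * m))"
    by (simp only: v_power_mult flip: power_mult)
  then have "v (b ^ ((i - j) * (n * m))) + (v (a ^ (n * m)) + v (x ^ (k * m))) + v (x ^ (k' * n))
      = (v (a' ^ (n * m)) + v (x ^ (k' * n))) + v (x ^ (k * m))"
    by (metis v_commute v_left_commute add.assoc)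
  then have "v (b ^ ((i - j) * (n * m)) * x ^ (l * m + k' * n)) = v (x ^ (l' * n + k * m))"
    unfolding A A' by (simp add: v_mult power_add add.assoc)
  then show ?thesis
    unfolding x_torsion_def using \<open>j < i\<close> n(1) m(1) by (intro exI[of _ "(i - j) * (n * m)"]) auto
qed

end


section \<open>Minimum of the logarithmic derivative\<close>

context weyl_valuation
begin

lemma x_power_mono: "0 < v x \<Longrightarrow> m \<le> n \<Longrightarrow> v (x ^ m) \<le> v (x ^ n)"
  and x_power_antimono: "v x < 0 \<Longrightarrow> m \<le> n \<Longrightarrow> v (x ^ n) \<le> v (x ^ m)"
proof -
  have pos: "0 \<le> v (x ^ k)" if "0 < v x" for k
    using v_power_less_power[of 1 x k] that by (cases k) auto
  have neg: "v (x ^ k) \<le> 0" if "v x < 0" for k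
    using v_power_less_power[of x 1 k] that by (cases k) auto
  have split: "v (x ^ n) = v (x ^ m) + v (x ^ (n - m))" if "m \<le> n"
    using that by (simp flip: v_mult power_add)
  show "0 < v x \<Longrightarrow> m \<le> n \<Longrightarrow> v (x ^ m) \<le> v (x ^ n)"
    using split val_add_left_mono[OF pos[of "n - m"], of "v (x ^ m)"] by simp
  show "v x < 0 \<Longrightarrow> m \<le> n \<Longrightarrow> v (x ^ n) \<le> v (x ^ m)"
    using split val_add_left_mono[OF neg[of "n - m"], of "v (x ^ m)"] by simp
qed

section \<open>Cosets of the integer multiples of \<open>v x\<close>\<close>

definition cong_x :: "'a \<Rightarrow> 'a \<Rightarrow> bool" where
  "cong_x a b \<longleftrightarrow> (\<exists>k l. v (x ^ k * a) = v (x ^ l * b))"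

lemma cong_x_sym: "cong_x a b \<Longrightarrow> cong_x b a"
  unfolding cong_x_def by metis

text \<open>Elements killed by \<open>der ^^ d\<close> have degree below \<open>d\<close> in
  \<open>y\<close>; counting their multiples by powers of \<open>x\<close>, as in a module of rank
  \<open>d\<close>, leaves at most \<open>d\<close> cosets.\<close>

lemma cong_x_pigeonhole:
  assumes F: "finite F" "d < card F" and low: "\<And>a. a \<in> F \<Longrightarrow> a \<noteq> 0 \<and> (der ^^ d) a = 0"
  obtains a b where "a \<in> F" "b \<in> F" "a \<noteq> b" "cong_x a b"
proof -
  have "F \<noteq> {}" using F by auto
  then obtain e where d: "d = Suc e" using low by (cases d) auto
  have "\<exists>C. \<forall>a\<in>F. a \<in> box C e"
    using F(1) low
  proof (induction F rule: finite_induct)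
    case (insert a F)
    then obtain C where C: "\<forall>a\<in>F. a \<in> box C e" by blast
    obtain m n where "a \<in> box m n" using generated[of a] by blast
    then have "a \<in> box m e" using insert.prems[of a] d by (simp add: box_reduce del: funpow.simps)
    then have "\<forall>a\<in>insert a F. a \<in> box (C + m) e"
      using C by (auto elim!: box_mono)
    then show ?case ..
  qed simp
  then obtain C where C: "\<forall>a\<in>F. a \<in> box C e" ..
  \<comment> \<open>For this \<open>N\<close>, \<open>Suc N * Suc d\<close> exceeds
    \<open>(N + C + 1) * d\<close> by exactly one.\<close>
  define N where "N = C * d"
  have "(N + C + 1) * d < Suc N * Suc d" by (simp add: N_def algebra_simps)
  also have "\<dots> \<le> Suc N * card F" using F by (intro mult_le_mono) auto
  also have "\<dots> = card ({..N} \<times> F)" by (simp add: card_cartesian_product)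
  finally have card: "Suc (N + C) * Suc e < card ({..N} \<times> F)" by (simp add: d)
  have box: "x ^ k * a \<in> box (N + C) e" if "k \<le> N" "a \<in> F" for k a
    using box_mult[OF box_base[of k N 0 0], of a C e] that C by simp
  obtain s t where st: "s \<in> {..N} \<times> F" "t \<in> {..N} \<times> F" "s \<noteq> t"
    "v (x ^ fst s * snd s) = v (x ^ fst t * snd t)"
  proof (rule value_collision[of "{..N} \<times> F" "\<lambda>s. x ^ fst s * snd s" "N + C" e])
    show "(\<lambda>s. x ^ fst s * snd s) ` ({..N} \<times> F) \<subseteq> box (N + C) e" using box by auto
    show "x ^ fst s * snd s \<noteq> 0" if "s \<in> {..N} \<times> F" for s using that low by auto
    show "Suc (N + C) * Suc e < card ({..N} \<times> F)" by (rule card)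
    show "finite ({..N} \<times> F)" using F by simp
  qed
  have "snd s \<noteq> snd t"
  proof
    assume eq: "snd s = snd t"
    have "snd t \<noteq> 0" using st low by auto
    then have "v (x ^ fst s) = v (x ^ fst t)"
      using st(4) eq val_add_right_cancel[of "v (snd t)"] by (simp add: v_mult)
    then have "fst s = fst t" using v_power_inj v_x by auto
    then show False using eq st(3) by (simp add: prod_eq_iff)
  qed
  moreover have "cong_x (snd s) (snd t)" using st(4) unfolding cong_x_def by blast
  moreover have "snd s \<in> F" "snd t \<in> F" using st(1,2) by auto
  ultimately show ?thesis by (intro that[of "snd s" "snd t"])
qed

text \<open>The pigeonhole bound gives a largest family \<open>F\<close> of pairwise incongruent
  elements, which meets every coset. The product of the denominators of its members serves for all
  elements.\<close>

lemma uniform_x_torsion: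
  assumes tor: "\<And>a. a \<noteq> 0 \<Longrightarrow> (der ^^ d) a = 0 \<Longrightarrow> x_torsion a"
  obtains N where "0 < N"
    "\<And>a. a \<noteq> 0 \<Longrightarrow> (der ^^ d) a = 0 \<Longrightarrow> \<exists>k l. v (a ^ N) + v (x ^ k) = v (x ^ l)"
proof -
  define P where "P F \<longleftrightarrow> finite F \<and> (\<forall>a\<in>F. a \<noteq> 0 \<and> (der ^^ d) a = 0) \<and>
    (\<forall>a\<in>F. \<forall>b\<in>F. a \<noteq> b \<longrightarrow> \<not> cong_x a b)" for F
  have "card F \<le> d" if PF: "P F" for F
  proof (rule ccontr)
    assume "\<not> card F \<le> d"
    moreover have F: "finite F" "\<And>a. a \<in> F \<Longrightarrow> a \<noteq> 0 \<and> (der ^^ d) a = 0"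
      using PF by (auto simp: P_def)
    ultimately obtain a b where "a \<in> F" "b \<in> F" "a \<noteq> b" "cong_x a b"
      using cong_x_pigeonhole[of F d] by (metis not_le)
    then show False using PF unfolding P_def by blast
  qed
  moreover have "P {}" by (simp add: P_def)
  ultimately have "\<exists>F. P F \<and> (\<forall>G. P G \<longrightarrow> card G \<le> card F)"
    by (intro ex_has_greatest_nat[of P "{}" card "Suc d"]) (auto simp: less_Suc_eq_le)
  then obtain F where F: "P F" and max: "\<And>G. P G \<Longrightarrow> card G \<le> card F" by metis
  have low: "finite F" "\<And>r. r \<in> F \<Longrightarrow> r \<noteq> 0 \<and> (der ^^ d) r = 0" using F by (auto simp: P_def)
  define n where "n r = (SOME n. 0 < n \<and> (\<exists>k l. v (r ^ n * x ^ k) = v (x ^ l)))" for r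
  have n: "0 < n r" "\<exists>k l. v (r ^ n r * x ^ k) = v (x ^ l)" if "r \<in> F" for r
    using someI_ex[of "\<lambda>n. 0 < n \<and> (\<exists>k l. v (r ^ n * x ^ k) = v (x ^ l))"] low(2)[OF that] tor[of r]
    unfolding n_def x_torsion_def by auto
  define N where "N = prod n F"
  have "0 < N" unfolding N_def using n(1) by (rule prod_pos)
  moreover have "\<exists>k l. v (a ^ N) + v (x ^ k) = v (x ^ l)" if a: "a \<noteq> 0" "(der ^^ d) a = 0" for a
  proof -
    have "\<exists>r\<in>F. cong_x a r"
    proof (cases "a \<in> F")
      case True
      then show ?thesis unfolding cong_x_def by blast
    next
      case False
      then have "card (insert a F) = Suc (card F)" using low(1) by simp
      then have not: "\<not> P (insert a F)" using max[of "insert a F"] by linarith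
      show ?thesis
      proof (rule ccontr)
        assume "\<not> ?thesis"
        then have "\<forall>r\<in>F. \<not> cong_x a r \<and> \<not> cong_x r a" using cong_x_sym by blast
        then have "P (insert a F)" using F a by (auto simp: P_def)
        then show False using not by simp
      qed
    qed
    then obtain r k l where r: "r \<in> F" "v (x ^ k * a) = v (x ^ l * r)" unfolding cong_x_def by blast
    obtain p q where pq: "v (r ^ n r * x ^ p) = v (x ^ q)" using n(2)[OF r(1)] by blast
    have "n r dvd N" unfolding N_def using low(1) r(1) by (rule dvd_prodI)
    then obtain M where M: "N = n r * M" by (rule dvdE)
    have 1: "v (x ^ (k * N)) + v (a ^ N) = v (x ^ (l * N)) + v (r ^ N)"
      using v_power_cong[OF r(2), of N] by (simp add: v_power_mult power_mult)
    have 2: "v (r ^ N) + v (x ^ (p * M)) = v (x ^ (q * M))"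
      using v_power_cong[OF pq, of M] by (simp add: v_power_mult power_mult M)
    have "v (a ^ N) + v (x ^ (k * N + p * M)) = (v (x ^ (k * N)) + v (a ^ N)) + v (x ^ (p * M))"
      by (simp only: power_add v_mult v_ac)
    also have "\<dots> = v (x ^ (l * N)) + (v (r ^ N) + v (x ^ (p * M)))" by (simp only: 1 add.assoc)
    also have "\<dots> = v (x ^ (l * N + q * M))" by (simp only: 2 power_add v_mult)
    finally show ?thesis by blast
  qed
  ultimately show ?thesis using that by blast
qed

text \<open>The quantity \<open>v (der a) - v a\<close> exceeds \<open>v x\<close>, and on elements of bounded degree it lies in
  \<open>v x * (1/N)\<close> times the integers; hence it attains its minimum there.\<close>

lemma low_degree_minimum:
  assumes tor: "\<And>a. a \<noteq> 0 \<Longrightarrow> (der ^^ d) a = 0 \<Longrightarrow> x_torsion a"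
    and "(der ^^ d) a0 = 0" "der a0 \<noteq> 0"
  obtains s where "(der ^^ d) s = 0" "der s \<noteq> 0"
    "\<And>a. (der ^^ d) a = 0 \<Longrightarrow> v (a * der s) \<le> v (der a * s)"
proof -
  obtain N where N: "0 < N"
    "\<And>a. a \<noteq> 0 \<Longrightarrow> (der ^^ d) a = 0 \<Longrightarrow> \<exists>k l. v (a ^ N) + v (x ^ k) = v (x ^ l)"
    by (rule uniform_x_torsion[OF tor, of d]) blast+
  \<comment> \<open>\<open>t\<close> is \<open>N\<close> times \<open>v (der a) - v a - v x\<close>
    in units of the absolute value of \<open>v x\<close>; the case split puts \<open>x ^ t\<close>
    on the side where \<open>t\<close> is natural.\<close>
  define H where "H a t \<longleftrightarrow> (if 0 < v x then v (der a ^ N) = v (a ^ N) + v (x ^ N) + v (x ^ t)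
    else v (der a ^ N) + v (x ^ t) = v (a ^ N) + v (x ^ N))" for a t
  have sgn: "v x < 0" if "\<not> 0 < v x" using that v_x by (meson linorder_neqE)
  have ex: "\<exists>t. H a t" if a: "(der ^^ d) a = 0" "der a \<noteq> 0" for a
  proof -
    have nz: "a \<noteq> 0" using a by auto
    have "(der ^^ d) (der a) = 0" using der_pow_mono[OF a(1), of "Suc d"] by (simp add: der_pow_Suc del: funpow.simps)
    then obtain k l k' l' where 1: "v (a ^ N) + v (x ^ k) = v (x ^ l)"
      and 2: "v (der a ^ N) + v (x ^ k') = v (x ^ l')"
      using N(2)[OF nz a(1)] N(2)[OF a(2)] by blast
    have "v ((a * x) ^ N) < v (der a ^ N)"
      using v_der_gt[OF nz] a N(1) by (intro v_power_less_power) (auto simp: v_mult)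
    then have "v (a ^ N) + v (x ^ N) + v (x ^ (k + k')) < v (der a ^ N) + v (x ^ (k + k'))"
      by (intro val_add_right_strict_mono) (auto simp: v_power_mult)
    moreover have 3: "v (a ^ N) + v (x ^ N) + v (x ^ (k + k')) = v (x ^ (l + N + k'))"
    proof -
      have "v (a ^ N) + v (x ^ N) + v (x ^ (k + k')) = (v (a ^ N) + v (x ^ k)) + v (x ^ N) + v (x ^ k')"
        by (simp only: power_add v_mult v_ac)
      then show ?thesis unfolding 1 by (simp only: power_add v_mult v_ac)
    qed
    moreover have 4: "v (der a ^ N) + v (x ^ (k + k')) = v (x ^ (l' + k))"
    proof -
      have "v (der a ^ N) + v (x ^ (k + k')) = (v (der a ^ N) + v (x ^ k')) + v (x ^ k)"
        by (simp only: power_add v_mult v_ac)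
      then show ?thesis unfolding 2 by (simp only: power_add v_mult v_ac)
    qed
    ultimately have less: "v (x ^ (l + N + k')) < v (x ^ (l' + k))" by simp
    show ?thesis
    proof (cases "0 < v x")
      case True
      then have le: "l + N + k' \<le> l' + k" using x_power_mono[of "l' + k" "l + N + k'"] less by (meson leD nat_le_linear)
      define t where "t = l' + k - (l + N + k')"
      have "v (x ^ (l' + k)) = v (x ^ (l + N + k')) + v (x ^ t)"
        using le by (simp add: t_def flip: v_mult power_add)
      then have "v (der a ^ N) + v (x ^ (k + k')) = (v (a ^ N) + v (x ^ N) + v (x ^ t)) + v (x ^ (k + k'))"
        unfolding 3[symmetric] 4[symmetric] by (simp only: v_ac)
      then have "H a t" using True unfolding H_def by (subst (asm) val_add_right_cancel) auto
      then show ?thesis ..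
    next
      case False
      then have le: "l' + k \<le> l + N + k'" using x_power_antimono[of "l + N + k'" "l' + k"] less sgn by (meson leD nat_le_linear)
      define t where "t = l + N + k' - (l' + k)"
      have "v (x ^ (l + N + k')) = v (x ^ (l' + k)) + v (x ^ t)"
        using le by (simp add: t_def flip: v_mult power_add)
      then have "(v (der a ^ N) + v (x ^ t)) + v (x ^ (k + k')) = (v (a ^ N) + v (x ^ N)) + v (x ^ (k + k'))"
        unfolding 3[symmetric] 4[symmetric] by (simp only: v_ac)
      then have "H a t" using False unfolding H_def by (subst (asm) val_add_right_cancel) auto
      then show ?thesis ..
    qed
  qed
  define P where "P t \<longleftrightarrow> (\<exists>a. (der ^^ d) a = 0 \<and> der a \<noteq> 0 \<and> H a t)" for t
  have "\<exists>t. P t" using ex assms unfolding P_def by blast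
  then obtain t where t: "P t" "\<And>u. P u \<Longrightarrow> t \<le> u" using exists_least_iff[of P] by (auto simp: not_less[symmetric])
  then obtain s where s: "(der ^^ d) s = 0" "der s \<noteq> 0" "H s t" unfolding P_def by blast
  have "v (a * der s) \<le> v (der a * s)" if a: "(der ^^ d) a = 0" for a
  proof (cases "der a = 0")
    case False
    then obtain u where u: "H a u" "t \<le> u" using ex t(2) a unfolding P_def by blast
    have nz: "a \<noteq> 0" "s \<noteq> 0" using False s by auto
    show ?thesis
    proof (rule v_power_le_power)
      show "v ((a * der s) ^ N) \<le> v ((der a * s) ^ N)"
      proof (cases "0 < v x")
        case True
        have "v (a ^ N) + v (s ^ N) + v (x ^ N) + v (x ^ t) \<le> v (a ^ N) + v (s ^ N) + v (x ^ N) + v (x ^ u)"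
          using True u by (intro val_add_left_mono x_power_mono)
        then show ?thesis using True u s unfolding H_def by (simp add: v_power_mult v_ac)
      next
        case False
        have *: "v (der a ^ N) + v (x ^ u) = v (a ^ N) + v (x ^ N)"
          "v (der s ^ N) + v (x ^ t) = v (s ^ N) + v (x ^ N)"
          using False u s unfolding H_def by auto
        have "v ((a * der s) ^ N) + (v (x ^ t) + v (x ^ u)) = (v (der s ^ N) + v (x ^ t)) + (v (a ^ N) + v (x ^ u))"
          by (simp only: v_power_mult v_ac)
        also have "\<dots> = (v (a ^ N) + v (s ^ N) + v (x ^ N)) + v (x ^ u)"
          unfolding * by (simp only: v_ac)
        also have "\<dots> \<le> (v (a ^ N) + v (s ^ N) + v (x ^ N)) + v (x ^ t)"
          using False u sgn by (intro val_add_left_mono x_power_antimono)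
        also have "\<dots> = (v (der a ^ N) + v (x ^ u)) + (v (s ^ N) + v (x ^ t))"
          unfolding * by (simp only: v_ac)
        also have "\<dots> = v ((der a * s) ^ N) + (v (x ^ t) + v (x ^ u))"
          by (simp only: v_power_mult v_ac)
        finally show ?thesis
          using val_add_right_strict_mono[of "v ((der a * s) ^ N)" _ "v (x ^ t) + v (x ^ u)"]
          by (auto simp: not_less[symmetric])
      qed
    qed (use N nz s False in auto)
  qed simp
  then show ?thesis using that s by blast
qed

section \<open>Division with remainder over the kernel of \<open>der\<close>\<close>

lemma ker_der_commute: "der a = 0 \<Longrightarrow> der b = 0 \<Longrightarrow> a * b = b * a"
proof -
  assume der: "der a = 0" "der b = 0"
  obtain m n m' n' where "a \<in> box m n" "b \<in> box m' n'" using generated by meson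
  then have "a \<in> box m 0" "b \<in> box m' 0" using box_reduce[of a m n 0] box_reduce[of b m' n' 0] der by auto
  then show "a * b = b * a" by (rule box_zero_commute)
qed

text \<open>Pseudo-division by \<open>b\<close>, of degree \<open>d\<close> in \<open>y\<close>: its
  leading coefficient need not be invertible, so \<open>g\<close> is multiplied by a nonzero
  \<open>p\<close> in the kernel of \<open>der\<close>. The digits \<open>h i\<close> have degree
  below \<open>d\<close>.\<close>

lemma expansion:
  assumes b: "(der ^^ Suc d) b = 0" "(der ^^ d) b \<noteq> 0" and "0 < d"
  shows "(der ^^ n) g = 0 \<Longrightarrow> \<exists>p m h. p \<noteq> 0 \<and> der p = 0 \<and> (\<forall>i. (der ^^ d) (h i) = 0) \<and>
    p * g = (\<Sum>i<m. h i * b ^ i)"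
proof (induction n arbitrary: g rule: less_induct)
  case (less n)
  show ?case
  proof (cases "n \<le> d")
    case True
    then have "(der ^^ d) g = 0" using der_pow_mono less.prems by blast
    then show ?thesis
      by (intro exI[of _ 1] exI[of _ "Suc 0"] exI[of _ "\<lambda>_. g"]) simp
  next
    case False
    then obtain k where n: "n = Suc (d + k)" by (metis less_natE not_le)
    let ?m = "d + k"
    have top: "(der ^^ i) (a - (der ^^ i) a * (inverse (fact i) *\<^sub>R y ^ i)) = 0"
      if "der ((der ^^ i) a) = 0" for i a
      using that by (simp add: der_pow_const_mult der_pow_y_pow)
    \<comment> \<open>The coefficients of \<open>y ^ ?m\<close> in \<open>g\<close> and of
      \<open>y ^ d\<close> in \<open>b\<close>.\<close>
    define P where "P = inverse (fact ?m) *\<^sub>R (der ^^ ?m) g"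
    define Q where "Q = inverse (fact d) *\<^sub>R (der ^^ d) b"
    have P: "der P = 0" using less.prems by (simp add: P_def n)
    have Q: "der Q = 0" "Q \<noteq> 0" using b by (simp_all add: Q_def)
    have g: "(der ^^ ?m) (g - P * y ^ ?m) = 0"
      using top[of ?m g] less.prems by (simp add: P_def n)
    have bQ: "(der ^^ d) (b - Q * y ^ d) = 0"
      using top[of d b] b by (simp add: Q_def)
    have yk: "(der ^^ Suc k) (y ^ k) = 0" by (simp add: der_pow_y_pow)
    define r where "r = Q * g - P * y ^ k * b"
    have yQ: "(der ^^ k) (Q * y ^ k - y ^ k * Q) = 0"
      using Q by (simp add: der_pow_const_mult der_pow_mult_const der_pow_y_pow)
    have yd: "(der ^^ Suc d) (y ^ d) = 0" by (simp add: der_pow_y_pow)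
    \<comment> \<open>Each summand lacks the power \<open>y ^ ?m\<close>, the middle one because
      commuting \<open>Q\<close> past \<open>y ^ k\<close> lowers the degree.\<close>
    have r: "r = Q * (g - P * y ^ ?m) + P * ((Q * y ^ k - y ^ k * Q) * y ^ d) - P * (y ^ k * (b - Q * y ^ d))"
    proof -
      have "y ^ ?m = y ^ k * y ^ d" by (simp add: add.commute flip: power_add)
      then show ?thesis
        using ker_der_commute[OF P Q(1)]
        by (simp add: r_def algebra_simps) (simp add: mult.assoc[symmetric])
    qed
    have "(der ^^ ?m) ((Q * y ^ k - y ^ k * Q) * y ^ d) = 0"
      using der_pow_prod[OF yQ yd] by (simp add: add.commute)
    moreover have "(der ^^ ?m) (y ^ k * (b - Q * y ^ d)) = 0"
      using der_pow_prod[OF yk bQ] by (simp add: add.commute)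
    ultimately have "(der ^^ ?m) r = 0"
      using g P Q unfolding r by (simp add: der_pow_const_mult)
    then obtain p1 m1 h1 where 1: "p1 \<noteq> 0" "der p1 = 0" "\<forall>i. (der ^^ d) (h1 i) = 0"
      "p1 * r = (\<Sum>i<m1. h1 i * b ^ i)"
      using less.IH[of ?m r] n by auto
    \<comment> \<open>The quotient has degree at most \<open>k\<close>, and \<open>d\<close> is
      positive, so it can be expanded recursively too.\<close>
    have "(der ^^ Suc k) (P * y ^ k) = 0" using P yk by (simp add: der_pow_const_mult del: funpow.simps)
    moreover have "Suc k < n" using \<open>0 < d\<close> n by simp
    ultimately obtain p2 m2 h2 where 2: "p2 \<noteq> 0" "der p2 = 0" "\<forall>i. (der ^^ d) (h2 i) = 0"
      "p2 * (P * y ^ k) = (\<Sum>i<m2. h2 i * b ^ i)"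
      using less.IH by blast
    \<comment> \<open>The second expansion is multiplied by \<open>b\<close>, which shifts its
      index; hence the \<open>i - 1\<close>.\<close>
    define h where "h i = (if i < m1 then p2 * h1 i else 0) +
      (if 0 < i \<and> i < Suc m2 then p1 * h2 (i - 1) else 0)" for i
    let ?m' = "m1 + Suc m2"
    have "p1 * p2 * Q * g = p2 * (p1 * r) + p1 * (p2 * (P * y ^ k)) * b"
      using ker_der_commute[OF 1(2) 2(2)] by (simp add: r_def algebra_simps) (simp add: mult.assoc[symmetric])
    also have "\<dots> = (\<Sum>i<m1. p2 * h1 i * b ^ i) + (\<Sum>i<m2. p1 * h2 i * b ^ Suc i)"
      unfolding 1 2 by (simp add: sum_distrib_left sum_distrib_right mult.assoc power_commutes)
    also have "(\<Sum>i<m1. p2 * h1 i * b ^ i) = (\<Sum>i<?m'. (if i < m1 then p2 * h1 i else 0) * b ^ i)"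
      by (rule sum.mono_neutral_cong_left) auto
    also have "(\<Sum>i<m2. p1 * h2 i * b ^ Suc i) = (\<Sum>i<Suc m2. (if 0 < i \<and> i < Suc m2 then p1 * h2 (i - 1) else 0) * b ^ i)"
      by (subst sum.lessThan_Suc_shift) simp
    also have "\<dots> = (\<Sum>i<?m'. (if 0 < i \<and> i < Suc m2 then p1 * h2 (i - 1) else 0) * b ^ i)"
      by (rule sum.mono_neutral_cong_left) auto
    finally have "p1 * p2 * Q * g = (\<Sum>i<?m'. h i * b ^ i)"
      by (simp add: h_def ring_distribs sum.distrib)
    moreover have "\<forall>i. (der ^^ d) (h i) = 0"
      using 1 2 by (simp add: h_def der_pow_const_mult)
    ultimately show ?thesis
      using 1 2 Q by (intro exI[of _ "p1 * p2 * Q"] exI[of _ ?m'] exI[of _ h]) (auto simp: der_mult)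
  qed
qed

section \<open>Existence of a minimal logarithmic derivative\<close>

lemma le_v_sum: "finite F \<Longrightarrow> (\<And>i. i \<in> F \<Longrightarrow> z \<le> v (t i)) \<Longrightarrow> z \<le> v (sum t F)"
  by (induction F rule: finite_induct) (auto intro: le_v_add)

text \<open>Compares \<open>v (der s) - v s\<close> with \<open>v (der a) - v a\<close>,
  cross-multiplied so that \<open>der a = 0\<close> is covered.\<close>

definition minimal :: "'a \<Rightarrow> bool" where
  "minimal s \<longleftrightarrow> der s \<noteq> 0 \<and> (\<forall>a. v (a * der s) \<le> v (der a * s))"

text \<open>Both Leibniz terms satisfy the bound, so it passes to products and powers.\<close>

lemma derivation_bound_mult:
  assumes "v (a * der s) \<le> v (der a * s)" "v (b * der s) \<le> v (der b * s)"
  shows "v ((a * b) * der s) \<le> v (der (a * b) * s)"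
proof -
  have "v b + v (a * der s) \<le> v b + v (der a * s)" "v a + v (b * der s) \<le> v a + v (der b * s)"
    using assms by (auto intro: val_add_left_mono)
  then have "v ((a * b) * der s) \<le> v (der a * b * s)" "v ((a * b) * der s) \<le> v (a * der b * s)"
    by (simp_all only: v_mult v_ac)
  then show ?thesis by (simp add: der_mult ring_distribs le_v_add)
qed

text \<open>The bound is secured in degree below \<open>d\<close> and for \<open>b\<close>, then
  carried to every \<open>g\<close> by expansion in powers of \<open>b\<close>: the terms have
  distinct values, so none lies below the sum.\<close>

lemma minimal_exists:
  assumes "b0 \<noteq> 0" "\<not> x_torsion b0"
  shows "\<exists>s. minimal s"
proof -
  define P where "P d \<longleftrightarrow> (\<exists>b. b \<noteq> 0 \<and> (der ^^ Suc d) b = 0 \<and> \<not> x_torsion b)" for d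
  obtain n where "(der ^^ n) b0 = 0" using der_nilpotent by blast
  then have "P n" using assms der_pow_mono[of n b0 "Suc n"] unfolding P_def by (auto simp del: funpow.simps)
  then obtain d where d: "P d" "\<And>e. e < d \<Longrightarrow> \<not> P e" using exists_least_iff[of P] by auto
  then obtain b where b: "b \<noteq> 0" "(der ^^ Suc d) b = 0" "\<not> x_torsion b" unfolding P_def by blast
  have one: "x_torsion 1" unfolding x_torsion_def by (rule exI[of _ 1]) auto
  \<comment> \<open>In degree zero, the pigeonhole applied to \<open>1\<close> and \<open>b\<close>
    would make \<open>v b\<close> a multiple of \<open>v x\<close>.\<close>
  have "0 < d"
  proof (rule ccontr)
    assume "\<not> 0 < d"
    then have "der b = 0" using b by simp
    moreover have "b \<noteq> 1" using one b by auto
    ultimately obtain a c where "a \<in> {1, b}" "c \<in> {1, b}" "a \<noteq> c" "cong_x a c"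
      using b by (elim cong_x_pigeonhole[of "{1, b}" 1, rotated -1]) auto
    then have "cong_x b 1" using cong_x_sym by auto
    then obtain k l where "v (x ^ k * b) = v (x ^ l * 1)" unfolding cong_x_def by blast
    then have "v (b ^ 1 * x ^ k) = v (x ^ l)" by (simp add: v_mult v_commute)
    then show False using b(3) unfolding x_torsion_def by blast
  qed
  then obtain e where e: "d = Suc e" using gr0_conv_Suc by blast
  have tor: "x_torsion a" if "a \<noteq> 0" "(der ^^ d) a = 0" for a
    using d(2)[of e] e that unfolding P_def by auto
  have top: "(der ^^ d) b \<noteq> 0" using tor b by auto
  then have db: "der b \<noteq> 0" unfolding e der_pow_Suc by auto
  \<comment> \<open>The better of \<open>b\<close> and the minimizer from low degree; if
    \<open>der\<close> kills everything of degree below \<open>d\<close>, it is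
    \<open>b\<close>.\<close>
  obtain s where s: "der s \<noteq> 0" "v (b * der s) \<le> v (der b * s)"
    "\<And>a. (der ^^ d) a = 0 \<Longrightarrow> v (a * der s) \<le> v (der a * s)"
  proof (cases "\<exists>a. (der ^^ d) a = 0 \<and> der a \<noteq> 0")
    case False
    then show ?thesis using that[of b] db by (auto simp: v_mult v_commute)
  next
    case True
    then obtain s where s: "(der ^^ d) s = 0" "der s \<noteq> 0"
      "\<And>a. (der ^^ d) a = 0 \<Longrightarrow> v (a * der s) \<le> v (der a * s)"
      by (elim exE conjE) (rule low_degree_minimum[OF tor, of d]; blast)
    show ?thesis
    proof (cases "v (b * der s) \<le> v (der b * s)")
      case True
      then show ?thesis using that s by blast
    next
      case False
      have "v (a * der b) \<le> v (der a * b)" if "(der ^^ d) a = 0" for a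
      proof (rule ccontr)
        assume "\<not> ?thesis"
        moreover have "s \<noteq> 0" using s by auto
        ultimately have "v s + v (der a * b) < v s + v (a * der b)"
          by (intro val_add_left_strict_mono) auto
        also have "\<dots> = v a + v (der b * s)" by (simp only: v_mult v_ac)
        also have "\<dots> \<le> v a + v (b * der s)" using False by (intro val_add_left_mono) auto
        also have "\<dots> = v b + v (a * der s)" by (simp only: v_mult v_ac)
        also have "\<dots> \<le> v b + v (der a * s)" using s that by (intro val_add_left_mono) auto
        also have "\<dots> = v s + v (der a * b)" by (simp only: v_mult v_ac)
        finally show False by simp
      qed
      then show ?thesis using that[of b] db by (auto simp: v_mult v_commute)
    qed
  qed
  have "v (g * der s) \<le> v (der g * s)" for g
  proof -
    obtain n where "(der ^^ n) g = 0" using der_nilpotent by blast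
    from expansion[OF b(2) top \<open>0 < d\<close> this]
    obtain p m h where p: "p \<noteq> 0" "der p = 0" and h: "\<forall>i. (der ^^ d) (h i) = 0"
      and pg: "p * g = (\<Sum>i<m. h i * b ^ i)" by blast
    define F where "F = {i. i < m \<and> h i \<noteq> 0}"
    have F: "finite F" by (simp add: F_def)
    have pg: "p * g = (\<Sum>i\<in>F. h i * b ^ i)"
      unfolding pg by (rule sum.mono_neutral_right) (auto simp: F_def)
    \<comment> \<open>Equal values would force \<open>x_torsion b\<close>, since the coefficients
      have degree below \<open>d\<close>.\<close>
    have "inj_on (\<lambda>i. v (h i * b ^ i)) F"
    proof (rule linorder_inj_onI')
      fix i j assume ij: "i \<in> F" "j \<in> F" "i < j"
      show "v (h i * b ^ i) \<noteq> v (h j * b ^ j)"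
        using x_torsion_quotient[of "h j" "h i" b j i] ij h b tor by (auto simp: F_def)
    qed
    then have le: "v (p * g) \<le> v (h i * b ^ i)" if "i \<in> F" for i
      using sum_distinct_values[OF F, of "\<lambda>i. h i * b ^ i"] that unfolding pg by auto
    have pow: "v (b ^ i * der s) \<le> v (der (b ^ i) * s)" for i
      by (induction i) (auto intro: derivation_bound_mult s)
    have "v (p * g * der s) \<le> v (\<Sum>i\<in>F. der (h i * b ^ i) * s)"
    proof (rule le_v_sum[OF F])
      fix i assume "i \<in> F"
      then have "v (p * g * der s) \<le> v (h i * b ^ i * der s)"
        using le by (simp only: v_mult[of _ "der s"] val_add_right_mono)
      also have "\<dots> \<le> v (der (h i * b ^ i) * s)"
        using h s pow by (intro derivation_bound_mult) auto
      finally show "v (p * g * der s) \<le> v (der (h i * b ^ i) * s)" .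
    qed
    also have "(\<Sum>i\<in>F. der (h i * b ^ i) * s) = der (p * g) * s"
    proof -
      have "der (sum t F) = (\<Sum>i\<in>F. der (t i))" for t using F by (induction F rule: finite_induct) auto
      then show ?thesis unfolding pg by (simp add: sum_distrib_right)
    qed
    also have "\<dots> = p * (der g * s)" using p by (simp add: der_mult mult.assoc)
    finally have "v p + v (g * der s) \<le> v p + v (der g * s)" by (simp add: v_mult add.assoc)
    then show ?thesis
      using val_add_left_strict_mono[of "v (der g * s)" "v (g * der s)" "v p"] p
      by (auto simp: not_less[symmetric])
  qed
  then show ?thesis using s unfolding minimal_def by blast
qed

end


section \<open>The leading logarithmic derivative\<close>

text \<open>\<open>s\<close> is a minimal element whose derivative is no longer minimal, which makes
  \<open>chi (der s)\<close> vanish while \<open>chi s\<close> does not.\<close>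

locale minimal_element = weyl_valuation +
  fixes s
  assumes minimal_s: "minimal s" and der_s_not_minimal: "\<not> minimal (der s)"
begin

lemma der_s [simp]: "der s \<noteq> 0" and s_nonzero [simp]: "s \<noteq> 0"
  and minimal_le: "v (a * der s) \<le> v (der a * s)"
  using minimal_s by (auto simp: minimal_def)

text \<open>The residue of \<open>der a * s / (a * der s)\<close>, a logarithmic derivative in leading terms.\<close>

definition chi :: "'a \<Rightarrow> real" where
  "chi a = (THE r. v (a * der s) < v (der a * s - r *\<^sub>R (a * der s)))"

lemma chi_eqI:
  assumes "v (a * der s) < v (der a * s - r *\<^sub>R (a * der s))"
  shows "chi a = r"
  unfolding chi_def
proof (rule the_equality)
  fix r' assume r': "v (a * der s) < v (der a * s - r' *\<^sub>R (a * der s))"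
  have "v (a * der s) < v ((der a * s - r *\<^sub>R (a * der s)) - (der a * s - r' *\<^sub>R (a * der s)))"
    using assms r' by (rule less_v_diff)
  also have "\<dots> = v ((r' - r) *\<^sub>R (a * der s))" by (simp add: algebra_simps)
  finally show "r' = r" by (cases "r' = r") auto
qed fact

lemma chi_spec:
  assumes "a \<noteq> 0"
  shows "v (a * der s) < v (der a * s - chi a *\<^sub>R (a * der s))"
proof -
  have "\<exists>r. v (a * der s) < v (der a * s - r *\<^sub>R (a * der s))"
  proof (cases "v (der a * s) = v (a * der s)")
    case True
    have "v (der a * s) \<noteq> Infty" unfolding True using assms by simp
    then have "der a * s \<noteq> 0" by (simp only: v_Infty not_False_eq_True)
    from residue[OF True this] show ?thesis unfolding True .
  next
    case False
    then show ?thesis using minimal_le[of a] by (intro exI[of _ 0]) auto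
  qed
  then show ?thesis using chi_eqI by metis
qed

lemma chi_nonzero:
  assumes "chi a \<noteq> 0" "a \<noteq> 0"
  shows "v (der a * s) = v (a * der s)" "der a \<noteq> 0"
proof -
  have "v (chi a *\<^sub>R (a * der s)) < v (der a * s - chi a *\<^sub>R (a * der s))"
    using chi_spec[of a] assms by simp
  from v_add_eq[OF this] show eq: "v (der a * s) = v (a * der s)" using assms by simp
  have "v (a * der s) \<noteq> Infty" using assms by simp
  then show "der a \<noteq> 0" unfolding eq[symmetric] by simp
qed

text \<open>Minimality controls the error \<open>e\<close>: the value of \<open>der e * s\<close> is
  at least that of \<open>e * der s\<close>, so the leading term is undisturbed.\<close>

lemma chi_cong:
  assumes "v a = v b" "a \<noteq> 0" "b \<noteq> 0"
  shows "chi a = chi b"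
proof (rule chi_eqI)
  obtain r where r: "r \<noteq> 0" "lead a (r *\<^sub>R b)" using lead_exists assms by metis
  define e where "e = a - r *\<^sub>R b"
  have e: "v a < v e" using r by (simp add: lead_def e_def)
  have 0: "v (a * der s) < v (e * der s)"
    using e by (simp add: v_mult val_add_right_strict_mono)
  have 1: "v (a * der s) < v (r *\<^sub>R (der b * s - chi b *\<^sub>R (b * der s)))"
    using chi_spec[of b] assms r by (intro less_v_scaleR) (simp add: v_mult)
  have 2: "v (a * der s) < v (der e * s)" using 0 minimal_le[of e] by (rule less_le_trans)
  have 3: "v (a * der s) < v (chi b *\<^sub>R (e * der s))" using 0 by (rule less_v_scaleR)
  have "v (a * der s) < v (r *\<^sub>R (der b * s - chi b *\<^sub>R (b * der s)) + der e * s - chi b *\<^sub>R (e * der s))"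
    by (intro less_v_diff less_v_add 1 2 3)
  also have "r *\<^sub>R (der b * s - chi b *\<^sub>R (b * der s)) + der e * s - chi b *\<^sub>R (e * der s)
      = der a * s - chi b *\<^sub>R (a * der s)"
    unfolding e_def by (simp add: algebra_simps)
  finally show "v (a * der s) < v (der a * s - chi b *\<^sub>R (a * der s))" .
qed

text \<open>The Leibniz rule in leading terms; moving \<open>b\<close> past \<open>s\<close> and
  \<open>der s\<close> past \<open>b\<close> contributes the two signs.\<close>

lemma chi_mult_twisted:
  assumes nz: "a \<noteq> 0" "b \<noteq> 0"
  shows "chi (a * b) = comm b s * comm (der s) b * chi a + chi b"
proof (rule chi_eqI)
  define e1 where "e1 = b * s - comm b s *\<^sub>R (s * b)"
  define e2 where "e2 = der a * s - chi a *\<^sub>R (a * der s)"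
  define e3 where "e3 = der s * b - comm (der s) b *\<^sub>R (b * der s)"
  define e4 where "e4 = der b * s - chi b *\<^sub>R (b * der s)"
  have e: "v (b * s) < v e1" "v (a * der s) < v e2" "v (der s * b) < v e3" "v (b * der s) < v e4"
    using lead_comm[of b s] lead_comm[of "der s" b] chi_spec nz
    by (simp_all add: e1_def e2_def e3_def e4_def lead_def)
  let ?z = "v (a * b * der s)"
  have "v a + v (der s * b) < v a + v e3" "v (a * der s) + v b < v e2 + v b" "v a + v (b * der s) < v a + v e4"
    using e nz by (auto intro: val_add_left_strict_mono val_add_right_strict_mono)
  then have 1: "?z < v (a * e3)" "?z < v (e2 * b)" "?z < v (a * e4)"
    by (simp_all only: v_mult v_ac)
  \<comment> \<open>This error carries the factor \<open>der a\<close>, whose value minimality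
    bounds from below.\<close>
  have 2: "?z < v (der a * e1)"
  proof (cases "der a = 0")
    case True
    then show ?thesis using nz by (simp add: val_less_Infty_iff)
  next
    case False
    have "?z = v b + v (a * der s)" by (simp only: v_mult v_ac)
    also have "\<dots> \<le> v b + v (der a * s)" by (intro val_add_left_mono minimal_le)
    also have "\<dots> = v (der a) + v (b * s)" by (simp only: v_mult v_ac)
    also have "\<dots> < v (der a) + v e1" using e False by (intro val_add_left_strict_mono) auto
    finally show ?thesis by (simp only: v_mult)
  qed
  have "?z < v ((comm b s * chi a) *\<^sub>R (a * e3) + comm b s *\<^sub>R (e2 * b) + der a * e1 + a * e4)"
    by (intro less_v_add less_v_scaleR 1 2)
  also have "(comm b s * chi a) *\<^sub>R (a * e3) + comm b s *\<^sub>R (e2 * b) + der a * e1 + a * e4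
      = der (a * b) * s - (comm b s * comm (der s) b * chi a + chi b) *\<^sub>R (a * b * der s)"
    unfolding e1_def e2_def e3_def e4_def der_mult by (simp add: algebra_simps)
  finally show "?z < v (der (a * b) * s - (comm b s * comm (der s) b * chi a + chi b) *\<^sub>R (a * b * der s))" .
qed

lemma chi_s: "chi s \<noteq> 0"
proof
  assume "chi s = 0"
  then have "v (s * der s) < v (der s * s)" using chi_spec[of s] by simp
  then show False by (simp add: v_mult v_commute)
qed

text \<open>Otherwise the logarithmic derivatives of \<open>der s\<close> and \<open>s\<close> would
  have the same value, and \<open>der s\<close> would be minimal.\<close>

lemma chi_der_s: "chi (der s) = 0"
proof (rule ccontr)
  assume "chi (der s) \<noteq> 0"
  then have eq: "v (der (der s) * s) = v (der s * der s)" "der (der s) \<noteq> 0"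
    using chi_nonzero by auto
  have "v (a * der (der s)) \<le> v (der a * der s)" for a
  proof (rule ccontr)
    assume "\<not> ?thesis"
    then have "v s + v (der a * der s) < v s + v (a * der (der s))"
      by (intro val_add_left_strict_mono) auto
    also have "\<dots> = v a + v (der (der s) * s)" by (simp only: v_mult v_ac)
    also have "\<dots> = v (der s) + v (a * der s)" unfolding eq by (simp only: v_mult v_ac)
    also have "\<dots> \<le> v (der s) + v (der a * s)" by (intro val_add_left_mono minimal_le)
    also have "\<dots> = v s + v (der a * der s)" by (simp only: v_mult v_ac)
    finally show False by simp
  qed
  then show False using eq der_s_not_minimal by (auto simp: minimal_def)
qed

text \<open>The cocycle condition must be symmetric in \<open>a\<close> and \<open>b\<close> because \<open>chi\<close> depends only on the value;
  this kills the twist.\<close>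

lemma twist_trivial:
  assumes "b \<noteq> 0"
  shows "comm b s * comm (der s) b = 1"
proof -
  define k where "k b = comm b s * comm (der s) b" for b
  have sym: "k b * chi a + chi b = k a * chi b + chi a" if "a \<noteq> 0" "b \<noteq> 0" for a b
    using chi_cong[of "a * b" "b * a"] chi_mult_twisted that
    by (simp add: k_def v_mult v_commute)
  \<comment> \<open>For the pair \<open>s\<close>, \<open>der s\<close> the vanishing of
    \<open>chi (der s)\<close> isolates \<open>k (der s)\<close>; the pair \<open>s\<close>,
    \<open>b\<close> then isolates \<open>k b\<close>.\<close>
  have "k (der s) = 1" using sym[of s "der s"] chi_der_s chi_s by simp
  then have "comm (der s) s = 1" by (simp add: k_def comm_self)
  then have "k s = 1" by (simp add: k_def comm_self)
  then have "k b = 1" using sym[of s b] chi_s assms by simp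
  then show ?thesis by (simp add: k_def)
qed

lemma chi_mult: "a \<noteq> 0 \<Longrightarrow> b \<noteq> 0 \<Longrightarrow> chi (a * b) = chi a + chi b"
  using chi_mult_twisted[of a b] twist_trivial[of b] by simp

lemma chi_power: "a \<noteq> 0 \<Longrightarrow> chi (a ^ n) = real n * chi a"
proof (induction n)
  case 0
  show ?case using chi_mult[of 1 1] by simp
qed (simp add: chi_mult algebra_simps)

lemma comm_s_eq: "b \<noteq> 0 \<Longrightarrow> comm b s = comm b (der s)"
  using twist_trivial[of b] comm_swap[of b "der s"] lead_comm(2)[of b "der s"]
  by (simp add: field_simps)

lemma comm_of_chi_zero:
  assumes nz: "f \<noteq> 0" "b \<noteq> 0" and chi: "chi f = 0" "chi b = 0"
  shows "comm f b = 1"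
proof -
  obtain i j k i' j' k' where ne: "(i, j, k) \<noteq> (i', j', k')"
    and eq: "v (f ^ i * b ^ j * s ^ k) = v (f ^ i' * b ^ j' * s ^ k')"
    by (rule monomial_collision[OF nz s_nonzero])
  have "chi (f ^ i * b ^ j * s ^ k) = chi (f ^ i' * b ^ j' * s ^ k')"
    using eq nz by (intro chi_cong) auto
  then have k: "k = k'" using nz chi chi_s by (simp add: chi_mult chi_power)
  then have "v (f ^ i * b ^ j) = v (f ^ i' * b ^ j')"
    using eq by (simp add: v_mult[of _ "s ^ k'"] val_add_right_cancel)
  then show ?thesis using comm_dependent[OF nz] ne k by auto
qed

text \<open>If \<open>chi b \<noteq> 0\<close> then \<open>b\<close> can be replaced by \<open>der b\<close>, which has the same value up to
  \<open>v (der s) - v s\<close>.\<close>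

lemma comm_descent:
  "(der ^^ n) b = 0 \<Longrightarrow> f \<noteq> 0 \<Longrightarrow> b \<noteq> 0 \<Longrightarrow> comm f b \<noteq> 1 \<Longrightarrow>
    \<exists>c. c \<noteq> 0 \<and> comm f c \<noteq> 1 \<and> chi c = 0"
proof (induction n arbitrary: b)
  case (Suc n)
  show ?case
  proof (cases "chi b = 0")
    case False
    have db: "der b \<noteq> 0" using chi_nonzero[OF False] Suc.prems by simp
    have "comm f (der b * s) = comm f (b * der s)"
      using chi_nonzero(1)[OF False] Suc.prems db by (intro comm_cong_right) auto
    then have "comm f (der b) = comm f b"
      using Suc.prems db comm_s_eq[of f] lead_comm(2)[of f "der s"] by (simp add: comm_mult_right)
    then show ?thesis using Suc.IH[of "der b"] Suc.prems db by (simp add: der_pow_Suc del: funpow.simps)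
  qed (use Suc in auto)
qed simp

lemma comm_trivial:
  assumes "f \<noteq> 0" "b \<noteq> 0"
  shows "comm f b = 1"
proof (rule ccontr)
  assume "comm f b \<noteq> 1"
  then obtain c where c: "c \<noteq> 0" "comm f c \<noteq> 1" "chi c = 0"
    using comm_descent[of _ b f] der_nilpotent[of b] assms by blast
  then have "comm c f \<noteq> 1" using comm_swap[of f c] assms by simp
  then obtain g where "g \<noteq> 0" "comm c g \<noteq> 1" "chi g = 0"
    using comm_descent[of _ f c] der_nilpotent[of f] assms c by blast
  then show False using comm_of_chi_zero c by blast
qed

end


section \<open>Triviality of the commutation sign\<close>

context weyl_valuation
begin

lemma comm_eq_one:
  assumes "f \<noteq> 0" "b \<noteq> 0"
  shows "comm f b = 1"
proof (cases "x_torsion f \<and> x_torsion b")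
  case True
  then show ?thesis using comm_x_torsion assms by blast
next
  case False
  then obtain s0 where s0: "minimal s0" using minimal_exists assms by blast
  \<comment> \<open>The iterated derivatives of \<open>s0\<close> reach zero, which is not
    minimal.\<close>
  have "\<exists>s. minimal s \<and> \<not> minimal (der s)"
  proof (rule ccontr)
    assume "\<not> ?thesis"
    then have "minimal ((der ^^ n) s0)" for n by (induction n) (use s0 in auto)
    moreover obtain n where "(der ^^ n) s0 = 0" using der_nilpotent by blast
    ultimately show False by (metis minimal_def der_simps(1))
  qed
  then obtain s where "minimal s" "\<not> minimal (der s)" by blast
  then interpret minimal_element x y v s by unfold_locales
  show ?thesis using comm_trivial assms by blast
qed

lemma lead_commute: "a \<noteq> 0 \<Longrightarrow> b \<noteq> 0 \<Longrightarrow> lead (a * b) (b * a)"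
  using lead_comm(1)[of a b] comm_eq_one[of a b] by simp

end


section \<open>Passage to the quotient division ring\<close>

text \<open>By surjectivity of the natural map, the coset containing \<open>u\<close> is that of
  some \<open>j r\<close>.\<close>

lemma residue_of_residue_field:
  fixes w :: "'d::division_ring \<Rightarrow> 'g::linordered_group_add val"
  assumes res: "residue_field_real j w" and w: "ring_valuation w" and u: "0 \<le> w u"
  obtains r where "0 < w (u - j r)"
proof -
  interpret ring_valuation w by fact
  let ?I = "valuation_ideal w" and ?R = "valuation_ring w"
  have coset: "?I +>\<^bsub>?R\<^esub> a = {h + a | h. 0 < w h}" for a
    by (auto simp: a_r_coset_def' valuation_ring_def univ_ring_def valuation_ideal_def)
  have "?I +>\<^bsub>?R\<^esub> u \<in> carrier (residue_ring w)"
    using u by (auto simp: residue_ring_def FactRing_def A_RCOSETS_def' valuation_ring_def)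
  also have "carrier (residue_ring w) = (\<lambda>r. ?I +>\<^bsub>?R\<^esub> j r) ` carrier univ_ring"
    using res by (simp add: residue_field_real_def ring_iso_def bij_betw_def)
  finally obtain r where "?I +>\<^bsub>?R\<^esub> u = ?I +>\<^bsub>?R\<^esub> j r" by (rule imageE)
  moreover have "u \<in> ?I +>\<^bsub>?R\<^esub> u"
    unfolding coset by (auto intro!: exI[of _ 0] simp: val_less_Infty_iff)
  ultimately obtain h where "u = h + j r" "0 < w h" unfolding coset by blast
  then show ?thesis using that[of r] by simp
qed

theorem theorem3p9:
  fixes \<iota> :: "weyl \<Rightarrow> 'd::division_ring"
    and v :: "weyl \<Rightarrow> 'g::linordered_group_add val"
  assumes "quotient_division_ring \<iota>"
    and "valuation v"
    and "trivial_on_reals v"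
    and "residue_field_real (\<lambda>r. \<iota> (of_real r)) (extension \<iota> v)"
  shows "strongly_abelian (extension \<iota> v)"
proof -
  define w where "w = extension \<iota> v"
  have "valuation w \<and> (\<forall>a. w (\<iota> a) = v a)"
    unfolding w_def extension_def by (rule theI'[OF extension_exists_unique[OF assms(1,2)]])
  then have w: "valuation w" and ext: "w (\<iota> a) = v a" for a by auto
  interpret W: ring_valuation w using w by unfold_locales
  have add: "\<iota> (a + b) = \<iota> a + \<iota> b" and mult: "\<iota> (a * b) = \<iota> a * \<iota> b" and "inj \<iota>"
    and frac: "\<exists>a b. b \<noteq> 0 \<and> d = \<iota> a * inverse (\<iota> b)" for a b d
    using assms(1) unfolding quotient_division_ring_def by blast+
  have zero: "\<iota> 0 = 0" using add[of 0 0] by simp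
  have zero_iff: "\<iota> a = 0 \<longleftrightarrow> a = 0" for a using \<open>inj \<iota>\<close> zero by (metis injD)
  have diff: "\<iota> (a - b) = \<iota> a - \<iota> b" for a b using add[of "a - b" b] by simp
  interpret V: real_valuation v
  proof
    fix a b assume eq: "v a = v b" and a: "a \<noteq> 0"
    interpret V0: ring_valuation v using assms(2) by unfold_locales
    have b: "b \<noteq> 0" using eq a V0.v_Infty by metis
    \<comment> \<open>The quotient has value zero, hence a real residue; multiplying by
      \<open>\<iota> b\<close> clears the denominator.\<close>
    let ?u = "\<iota> a * inverse (\<iota> b)"
    have "w ?u + w (\<iota> b) = 0 + w (\<iota> b)"
    proof -
      have "w ?u + w (\<iota> b) = w (?u * \<iota> b)" by (simp only: W.v_mult)
      also have "?u * \<iota> b = \<iota> a" using b by (simp add: zero_iff mult.assoc)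
      finally show ?thesis using eq by (simp add: ext)
    qed
    then have "w ?u = 0" by (subst (asm) val_add_right_cancel) (use b in \<open>auto simp: zero_iff\<close>)
    then obtain r where r: "0 < w (?u - \<iota> (of_real r))"
      using residue_of_residue_field[OF assms(4)[folded w_def], of ?u] W.ring_valuation_axioms by auto
    have "0 + w (\<iota> b) < w (?u - \<iota> (of_real r)) + w (\<iota> b)"
      using r b by (intro val_add_right_strict_mono) (auto simp: zero_iff)
    also have "\<dots> = w ((?u - \<iota> (of_real r)) * \<iota> b)" by (simp only: W.v_mult)
    also have "(?u - \<iota> (of_real r)) * \<iota> b = \<iota> (a - r *\<^sub>R b)"
      using b by (simp add: diff mult zero_iff scaleR_conv_of_real left_diff_distrib mult.assoc)
    finally show "\<exists>r. v a < v (a - r *\<^sub>R b)" using eq by (auto simp: ext)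
  qed (rule assms)+
  have x_nonzero: "weyl_x - of_real r \<noteq> 0" for r
  proof
    assume "weyl_x - of_real r = 0"
    then have "weyl_y * of_real r - of_real r * weyl_y = 1" using weyl_commutator by simp
    then show False by (simp add: of_real_def)
  qed
  \<comment> \<open>If \<open>weyl_x\<close> has value zero, subtracting its residue makes the value
    positive; otherwise no shift is made.\<close>
  obtain r where r: "v (weyl_x - of_real r) \<noteq> 0"
  proof (cases "v weyl_x = 0")
    case True
    then obtain r where "v weyl_x < v (weyl_x - r *\<^sub>R 1)"
      using V.residue[of weyl_x 1] x_nonzero[of 0] by auto
    then show ?thesis using that[of r] True by (auto simp: of_real_def)
  qed (use that[of 0] in simp)
  define x where "x = weyl_x - of_real r"
  interpret P: weyl_pair x weyl_y
  proof
    show "weyl_y * x = x * weyl_y + 1"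
      using weyl_commutator by (simp add: x_def of_real_def algebra_simps)
  qed
  interpret L: weyl_valuation x weyl_y v
  proof
    show "\<exists>m n. a \<in> P.box m n" for a
    proof (induction a rule: weyl_induct)
      case x
      have "weyl_x = x ^ 1 * weyl_y ^ 0 + r *\<^sub>R (x ^ 0 * weyl_y ^ 0)" by (simp add: x_def of_real_def)
      also have "\<dots> \<in> P.box 1 0" by (intro P.box_closed P.box_base) auto
      finally show ?case by blast
    next
      case y
      have "x ^ 0 * weyl_y ^ 1 \<in> P.box 0 1" by (rule P.box_base) auto
      then show ?case by auto
    next
      case (of_real r)
      have "r *\<^sub>R 1 \<in> P.box 0 0" by (intro P.box_closed P.box_one)
      then show ?case by (auto simp: of_real_def)
    next
      case (add a b)
      then obtain m n m' n' where "a \<in> P.box m n" "b \<in> P.box m' n'" by blast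
      then have "a + b \<in> P.box (m + m') (n + n')"
        by (intro P.box_closed) (auto elim: P.box_mono)
      then show ?case by blast
    next
      case (mult a b)
      then show ?case using P.box_mult by blast
    qed
  qed (use r x_nonzero in \<open>auto simp: x_def\<close>)
  \<comment> \<open>Leading commutation holds on the image of \<open>\<iota>\<close> and passes to
    products and inverses in the first argument; symmetry extends it to fractions on both
    sides.\<close>
  define R where "R c d \<longleftrightarrow> c \<noteq> 0 \<and> d \<noteq> 0 \<and> W.lead (c * d) (d * c)" for c d
  have R_sym: "R d c" if "R c d" for c d
    using that W.lead_sym by (auto simp: R_def)
  have R_base: "R (\<iota> a) (\<iota> b)" if "a \<noteq> 0" "b \<noteq> 0" for a b
    using L.lead_commute[OF that] that
    by (simp add: R_def zero_iff W.lead_def V.lead_def flip: mult diff ext)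
  have R_mult: "R (c * d) e" if "R c e" "R d e" for c d e
  proof -
    have "W.lead (c * (d * e)) (c * (e * d))" "W.lead ((c * e) * d) ((e * c) * d)"
      using that by (auto simp: R_def intro: W.lead_mult_left W.lead_mult_right)
    then have "W.lead (c * d * e) (e * (c * d))" using W.lead_trans by (simp add: mult.assoc)
    then show ?thesis using that by (simp add: R_def)
  qed
  have R_inverse: "R (inverse c) d" if "R c d" for c d
  proof -
    have c: "c \<noteq> 0" using that by (simp add: R_def)
    have "W.lead (inverse c * (c * d) * inverse c) (inverse c * (d * c) * inverse c)"
      using that by (auto simp: R_def intro!: W.lead_mult_left W.lead_mult_right)
    then have "W.lead (d * inverse c) (inverse c * d)"
      using c by (simp add: mult.assoc[symmetric]) (simp add: mult.assoc)
    then show ?thesis using that W.lead_sym by (auto simp: R_def)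
  qed
  have R_frac: "R d (\<iota> c)" if "d \<noteq> 0" "c \<noteq> 0" for d c
  proof -
    obtain a b where "b \<noteq> 0" "d = \<iota> a * inverse (\<iota> b)" using frac by blast
    moreover from this have "a \<noteq> 0" using that zero by auto
    ultimately show ?thesis using R_mult[OF R_base R_inverse[OF R_base], of a c b] that by simp
  qed
  have "R d e" if "d \<noteq> 0" "e \<noteq> 0" for d e
  proof -
    obtain a b where "b \<noteq> 0" "d = \<iota> a * inverse (\<iota> b)" using frac by blast
    moreover from this have "a \<noteq> 0" using that zero by auto
    ultimately show ?thesis
      using R_mult[OF R_sym[OF R_frac] R_inverse[OF R_sym[OF R_frac]], of e a b] that by simp
  qed
  then show ?thesis
    unfolding strongly_abelian_def w_def[symmetric] by (simp add: R_def W.lead_def)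
qed

end
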